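(* Let $r\ge 3$ be an integer, let $\varepsilon>0$ be constant and let $p=\frac{1+\varepsilon}{(r-1)\binom{n-1}{r-1}}$. Let $L_C$ and $L_P$ be the lengths of the longest loose cycle and of the longest loose path, respectively, in $H^r(n,p)$. Then with high probability $$L_C\le L_P+1\le \left(\frac{2\varepsilon^2}{(r-1)^2}+O(\varepsilon^3)\right)\cdot n,$$ where the $O(\varepsilon^3)$ term is bounded in absolute value by $K\varepsilon^3$ for a constant $K=K(r)$ depending only on $r$.
   Context: "With high probability" means with probability tending to $1$ as $n\to\infty$ (with $r,\varepsilon$ fixed). $H^r(n,p)$ is the random $r$-uniform hypergraph on vertex set $[n]$ in which each $r$-subset of $[n]$ is an edge independently with probability $p$. A loose path of length $\ell$ in an $r$-uniform hypergraph is a sequence of distinct vertices $v_1,\dots,v_{\ell(r-1)+1}$ and a sequence of edges $e_1,\dots,e_\ell$ with $e_i=\{v_{(i-1)(r-1)+1},\dots,v_{(i-1)(r-1)+r}\}$ for $i\in[\ell]$. A loose cycle of length $\ell$ is defined similarly, except that $v_{\ell(r-1)+1}=v_1$ (and otherwise all vertices are distinct). *)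

theory Defs
  imports "HOL-Probability.Probability"
begin

text \<open>A hypergraph is given by its vertex set \<open>V\<close> and its set of edges \<open>E\<close>.\<close>

text \<open>\<open>bernoulli_pmf\<close> truncates its parameter to \<open>[0, 1]\<close>, so for those small \<open>n\<close> where a given
  formula for \<open>p\<close> exceeds 1 the model is still a probability distribution.\<close>

definition random_hypergraph :: "nat \<Rightarrow> nat \<Rightarrow> real \<Rightarrow> nat set set pmf" where
  "random_hypergraph r n p =
     map_pmf (\<lambda>chosen. {e. chosen e})
       (Pi_pmf {e. e \<subseteq> {1..n} \<and> card e = r} False (\<lambda>_. bernoulli_pmf p))"

definition loose_path ::
  "nat \<Rightarrow> 'a set \<Rightarrow> 'a set set \<Rightarrow> nat \<Rightarrow> (nat \<Rightarrow> 'a) \<Rightarrow> (nat \<Rightarrow> 'a set) \<Rightarrow> bool" where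
  "loose_path r V E l v e \<longleftrightarrow>
     v ` {1..l * (r - 1) + 1} \<subseteq> V \<and>
     inj_on v {1..l * (r - 1) + 1} \<and>
     (\<forall>i\<in>{1..l}. e i \<in> E \<and> e i = v ` {(i - 1) * (r - 1) + 1..(i - 1) * (r - 1) + r})"

text \<open>Two edges meeting in exactly two vertices form a loose cycle of length 2. Length 1 is ruled
  out in an \<open>r\<close>-uniform hypergraph with \<open>r \<ge> 2\<close>, because \<open>e 1\<close> would have only \<open>r - 1\<close> vertices.\<close>

definition loose_cycle ::
  "nat \<Rightarrow> 'a set \<Rightarrow> 'a set set \<Rightarrow> nat \<Rightarrow> (nat \<Rightarrow> 'a) \<Rightarrow> (nat \<Rightarrow> 'a set) \<Rightarrow> bool" where
  "loose_cycle r V E l v e \<longleftrightarrow>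
     l \<ge> 1 \<and>
     v ` {1..l * (r - 1) + 1} \<subseteq> V \<and>
     v (l * (r - 1) + 1) = v 1 \<and>
     inj_on v {1..l * (r - 1)} \<and>
     (\<forall>i\<in>{1..l}. e i \<in> E \<and> e i = v ` {(i - 1) * (r - 1) + 1..(i - 1) * (r - 1) + r})"

text \<open>The inserted 0 fixes the value when there is no loose cycle (or no vertex at all). For finite
  \<open>V\<close> and \<open>r \<ge> 2\<close> the sets of lengths are finite, so \<open>Max\<close> is meaningful.\<close>

definition longest_loose_path :: "nat \<Rightarrow> 'a set \<Rightarrow> 'a set set \<Rightarrow> nat" where
  "longest_loose_path r V E = Max (insert 0 {l. \<exists>v e. loose_path r V E l v e})"

definition longest_loose_cycle :: "nat \<Rightarrow> 'a set \<Rightarrow> 'a set set \<Rightarrow> nat" where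
  "longest_loose_cycle r V E = Max (insert 0 {l. \<exists>v e. loose_cycle r V E l v e})"

end

theory Submission
  imports Defs "HOL-Real_Asymp.Real_Asymp"
begin

text \<open>All but boundedly many edges of a long loose path have two distinct vertices from which
  edge-disjoint trails of a fixed length \<open>k\<close> leave, one along each half of the path; call such an
  edge a bridge. With \<open>m = r - 1\<close>, the Harris inequality yields the branching process recursion
  \<open>1 - Q\<^bsub>k+1\<^esub> \<ge> (1 - p * (1 - (1 - Q\<^bsub>k\<^esub>) ^ m)) ^ N\<close> for the probability \<open>Q\<^bsub>k\<^esub>\<close> that a vertex
  starts a trail of length \<open>k\<close>, where \<open>N\<close> is the number of potential edges at a vertex; for large
  \<open>k\<close> it gives \<open>Q\<^bsub>k\<^esub> \<le> 2 * \<epsilon> / m + O(\<epsilon>\<^sup>2)\<close>. By the van den Berg--Kesten inequality an edge is a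
  bridge with probability at most \<open>p * (r choose 2) * Q\<^bsub>k\<^esub>\<^sup>2\<close>, so the expected number of bridges is
  at most \<open>(2 * \<epsilon>\<^sup>2 / m\<^sup>2 + O(\<epsilon>\<^sup>3)) * n\<close>. For concentration, cut the path into segments of a fixed
  length \<open>t\<close> much larger than \<open>k\<close> and consider the maximal number of disjoint \<open>t\<close>-segments
  consisting mostly of bridges: it changes by at most 1 when one edge is added, so its variance is
  \<open>O(n)\<close> and Chebyshev's inequality applies. The claim is trivial for \<open>\<epsilon> \<ge> 1/4\<close>, and a loose cycle
  minus an edge is a loose path.\<close>

section \<open>Random subsets of a finite set\<close>

text \<open>The construction of \<open>random_hypergraph\<close> over an arbitrary ground set, so
  that the inequalities below can be proved by induction on that set.\<close>

definition random_subset :: "'a set \<Rightarrow> real \<Rightarrow> 'a set pmf" where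
  "random_subset X p =
     map_pmf (\<lambda>chosen. {e. chosen e}) (Pi_pmf X False (\<lambda>_. bernoulli_pmf p))"

lemma set_random_subset:
  assumes "finite X"
  shows "set_pmf (random_subset X p) \<subseteq> Pow X"
  using assms by (auto simp: random_subset_def set_Pi_pmf PiE_dflt_def)

lemma finite_set_random_subset:
  "finite X \<Longrightarrow> finite (set_pmf (random_subset X p))"
  by (meson finite_Pow_iff finite_subset set_random_subset)

lemma integrable_random_subset:
  fixes f :: "'a set \<Rightarrow> real"
  shows "finite X \<Longrightarrow> integrable (measure_pmf (random_subset X p)) f"
  by (intro integrable_measure_pmf_finite finite_set_random_subset)

lemma random_subset_empty: "random_subset {} p = return_pmf {}"
  by (simp add: random_subset_def)

lemma random_subset_insert:
  assumes "finite X" "x \<notin> X"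
  shows "random_subset (insert x X) p =
    bernoulli_pmf p \<bind> (\<lambda>b. map_pmf (\<lambda>S. if b then insert x S else S) (random_subset X p))"
proof -
  have *: "{e. (f(x := b)) e} = (if b then insert x {e. f e} else {e. f e})"
    if "f \<in> set_pmf (Pi_pmf X False (\<lambda>_. bernoulli_pmf p))" for f b
  proof -
    have "\<not> f x" using that assms by (auto simp: set_Pi_pmf PiE_dflt_def)
    then show ?thesis by auto
  qed
  show ?thesis
    unfolding random_subset_def Pi_pmf_insert'[OF assms] map_bind_pmf map_return_pmf
      pmf.map_comp o_def
    by (intro bind_pmf_cong refl) (auto simp: map_pmf_def * intro!: bind_pmf_cong)
qed

lemma expectation_random_subset_insert:
  fixes f :: "'a set \<Rightarrow> real"
  assumes "finite X" "x \<notin> X" "0 \<le> p" "p \<le> 1"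
  shows "measure_pmf.expectation (random_subset (insert x X) p) f =
    (1 - p) * measure_pmf.expectation (random_subset X p) f +
    p * measure_pmf.expectation (random_subset X p) (\<lambda>S. f (insert x S))"
  unfolding random_subset_insert[OF assms(1,2)]
  using assms finite_set_random_subset[OF assms(1), of p]
  by (subst pmf_expectation_bind[where A = UNIV]) (auto simp: UNIV_bool)

lemma prob_random_subset_insert:
  assumes "finite X" "x \<notin> X" "0 \<le> p" "p \<le> 1"
  shows "measure_pmf.prob (random_subset (insert x X) p) A =
    (1 - p) * measure_pmf.prob (random_subset X p) A +
    p * measure_pmf.prob (random_subset X p) {S. insert x S \<in> A}"
proof -
  have 1: "measure_pmf.prob (random_subset Y p) A = measure_pmf.expectation (random_subset Y p) (indicator A)"
    for Y :: "'a set" and A by simp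
  have 2: "(\<lambda>S. indicator A (insert x S)) = (indicator {S. insert x S \<in> A} :: 'a set \<Rightarrow> real)"
    by (auto simp: indicator_def)
  show ?thesis
    unfolding 1 expectation_random_subset_insert[OF assms] 2 ..
qed

section \<open>Increasing events and correlation inequalities\<close>

text \<open>An increasing event is represented by generators, since disjoint occurrence refers to
  witnesses and not to the event alone.\<close>

definition occurs :: "'a set set \<Rightarrow> 'a set set" where
  "occurs F = {S. \<exists>a\<in>F. a \<subseteq> S}"

text \<open>Generators of the disjoint occurrence of two increasing events, as in the van den
  Berg-Kesten inequality.\<close>

definition disjoint_unions :: "'a set set \<Rightarrow> 'a set set \<Rightarrow> 'a set set" where
  "disjoint_unions F G = {a \<union> b |a b. a \<in> F \<and> b \<in> G \<and> a \<inter> b = {}}"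

text \<open>Conditioning on the presence of \<open>x\<close> keeps an event within the class, with
  \<open>x\<close> deleted from its generators; this drives the inductions below.\<close>

lemma insert_in_occurs: "{S. insert x S \<in> occurs F} = occurs ((\<lambda>a. a - {x}) ` F)"
  by (auto simp: occurs_def)

lemma occurs_remove: "occurs F \<subseteq> occurs ((\<lambda>a. a - {x}) ` F)"
  by (auto simp: occurs_def)

lemma occurs_Un: "occurs (F \<union> G) = occurs F \<union> occurs G"
  by (auto simp: occurs_def)

text \<open>At most one of two disjoint witnesses uses \<open>x\<close>, so it suffices to delete
  \<open>x\<close> on one side.\<close>

lemma insert_in_occurs_disjoint_unions:
  "{S. insert x S \<in> occurs (disjoint_unions F G)} \<subseteq>
    occurs (disjoint_unions ((\<lambda>a. a - {x}) ` F) G) \<union>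
    occurs (disjoint_unions F ((\<lambda>a. a - {x}) ` G))"
proof (rule subsetI, drule CollectD)
  fix S assume "insert x S \<in> occurs (disjoint_unions F G)"
  then obtain a b where ab: "a \<in> F" "b \<in> G" "a \<inter> b = {}" "a \<union> b \<subseteq> insert x S"
    by (auto simp: occurs_def disjoint_unions_def)
  show "S \<in> occurs (disjoint_unions ((\<lambda>a. a - {x}) ` F) G) \<union>
    occurs (disjoint_unions F ((\<lambda>a. a - {x}) ` G))"
  proof (cases "x \<in> b")
    case True
    then have "a \<union> (b - {x}) \<in> disjoint_unions F ((\<lambda>a. a - {x}) ` G)"
      unfolding disjoint_unions_def using ab by blast
    moreover have "a \<union> (b - {x}) \<subseteq> S" using ab True by blast
    ultimately show ?thesis unfolding occurs_def by blast
  next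
    case False
    then have "(a - {x}) \<union> b \<in> disjoint_unions ((\<lambda>a. a - {x}) ` F) G"
      unfolding disjoint_unions_def using ab by blast
    moreover have "(a - {x}) \<union> b \<subseteq> S" using ab False by blast
    ultimately show ?thesis unfolding occurs_def by blast
  qed
qed

lemma occurs_disjoint_unions_remove:
  "occurs (disjoint_unions F G) \<subseteq>
    occurs (disjoint_unions ((\<lambda>a. a - {x}) ` F) G) \<inter>
    occurs (disjoint_unions F ((\<lambda>a. a - {x}) ` G))"
proof
  fix S assume "S \<in> occurs (disjoint_unions F G)"
  then obtain a b where ab: "a \<in> F" "b \<in> G" "a \<inter> b = {}" "a \<union> b \<subseteq> S"
    by (auto simp: occurs_def disjoint_unions_def)
  have "a \<union> (b - {x}) \<in> disjoint_unions F ((\<lambda>a. a - {x}) ` G)"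
    "(a - {x}) \<union> b \<in> disjoint_unions ((\<lambda>a. a - {x}) ` F) G"
    unfolding disjoint_unions_def using ab by blast+
  moreover have "a \<union> (b - {x}) \<subseteq> S" "(a - {x}) \<union> b \<subseteq> S" using ab by blast+
  ultimately show "S \<in> occurs (disjoint_unions ((\<lambda>a. a - {x}) ` F) G) \<inter>
    occurs (disjoint_unions F ((\<lambda>a. a - {x}) ` G))"
    unfolding occurs_def by blast
qed

text \<open>A case of the van den Berg--Kesten inequality. The restriction \<open>p \<le> 1/2\<close> is what allows the
  induction hypothesis to be applied to \<open>F\<close> and \<open>G\<close> themselves, which enter with weight
  \<open>1 - 2 * p\<close>.\<close>

lemma prob_disjoint_unions_le:
  assumes "finite X" "0 \<le> p" "p \<le> 1/2"
  shows "measure_pmf.prob (random_subset X p) (occurs (disjoint_unions F G)) \<le>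
    measure_pmf.prob (random_subset X p) (occurs F) *
    measure_pmf.prob (random_subset X p) (occurs G)"
  using assms(1)
proof (induction X arbitrary: F G rule: finite_induct)
  case empty
  have "{} \<in> occurs (disjoint_unions F G) \<longleftrightarrow> {} \<in> occurs F \<and> {} \<in> occurs G"
    by (auto simp: occurs_def disjoint_unions_def)
  then show ?case
    by (auto simp: random_subset_empty indicator_def)
next
  case (insert x X)
  let ?P = "\<lambda>F. measure_pmf.prob (random_subset X p) F"
  let ?r = "\<lambda>F. (\<lambda>a. a - {x}) ` F"
  define f0 f1 g0 g1 where "f0 = ?P (occurs F)" "f1 = ?P (occurs (?r F))"
    "g0 = ?P (occurs G)" "g1 = ?P (occurs (?r G))"
  note defs = this
  let ?A = "occurs (disjoint_unions (?r F) G)" and ?B = "occurs (disjoint_unions F (?r G))"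
  let ?C = "occurs (disjoint_unions F G)"
  have "?P {S. insert x S \<in> ?C} \<le> ?P (?A \<union> ?B)"
    by (intro measure_pmf.finite_measure_mono insert_in_occurs_disjoint_unions) auto
  \<comment> \<open>The intersection of \<open>?A\<close> and \<open>?B\<close> contains
    \<open>?C\<close>, so inclusion-exclusion gains a term \<open>- ?P ?C\<close>; below it turns
    the weight \<open>1 - p\<close> of \<open>?C\<close> into \<open>1 - 2 * p\<close>.\<close>
  also have "\<dots> = ?P ?A + ?P ?B - ?P (?A \<inter> ?B)"
    by (subst measure_Un3) (auto simp: measure_pmf.fmeasurable_eq_sets)
  also have "\<dots> \<le> ?P ?A + ?P ?B - ?P ?C"
    using measure_pmf.finite_measure_mono[OF occurs_disjoint_unions_remove[of F G x]] by simp
  also have "\<dots> \<le> f1 * g0 + f0 * g1 - ?P ?C"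
    using insert.IH[of "?r F" G] insert.IH[of F "?r G"] by (simp add: defs)
  finally have 1: "?P {S. insert x S \<in> ?C} \<le> f1 * g0 + f0 * g1 - ?P ?C" .
  have 2: "f0 \<le> f1" "g0 \<le> g1"
    unfolding defs by (intro measure_pmf.finite_measure_mono occurs_remove, simp)+
  have "(1 - p) * ?P ?C + p * ?P {S. insert x S \<in> ?C} \<le>
      (1 - p) * ?P ?C + p * (f1 * g0 + f0 * g1 - ?P ?C)"
    using 1 assms by (intro add_mono mult_left_mono) auto
  also have "\<dots> = (1 - 2 * p) * ?P ?C + p * (f1 * g0 + f0 * g1)"
    by (simp add: algebra_simps)
  also have "\<dots> \<le> (1 - 2 * p) * (f0 * g0) + p * (f1 * g0 + f0 * g1)"
    using insert.IH[of F G] assms by (intro add_mono mult_left_mono) (auto simp: defs)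
  \<comment> \<open>The added term is nonnegative by monotonicity and completes the product of the
    two probabilities.\<close>
  also have "\<dots> \<le> (1 - 2 * p) * (f0 * g0) + p * (f1 * g0 + f0 * g1) + p\<^sup>2 * ((f1 - f0) * (g1 - g0))"
    using 2 by simp
  also have "\<dots> = ((1 - p) * f0 + p * f1) * ((1 - p) * g0 + p * g1)"
    by (simp add: algebra_simps power2_eq_square)
  finally show ?case
    using assms insert.hyps
    by (simp add: prob_random_subset_insert defs insert_in_occurs)
qed

text \<open>Given whether \<open>x\<close> is present, the induction hypothesis applies. Both
  conditional probabilities grow when \<open>x\<close> is present, so their covariance
  \<open>p * (1 - p) * ((f1 - f0) * (g1 - g0))\<close> is nonnegative.\<close>

lemma harris_inequality:
  assumes "finite X" "0 \<le> p" "p \<le> 1"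
  shows "measure_pmf.prob (random_subset X p) (occurs F) *
    measure_pmf.prob (random_subset X p) (occurs G) \<le>
    measure_pmf.prob (random_subset X p) (occurs F \<inter> occurs G)"
  using assms(1)
proof (induction X arbitrary: F G rule: finite_induct)
  case empty
  then show ?case
    by (auto simp: random_subset_empty indicator_def)
next
  case (insert x X)
  let ?P = "\<lambda>F. measure_pmf.prob (random_subset X p) F"
  let ?r = "\<lambda>F. (\<lambda>a. a - {x}) ` F"
  define f0 f1 g0 g1 where "f0 = ?P (occurs F)" "f1 = ?P (occurs (?r F))"
    "g0 = ?P (occurs G)" "g1 = ?P (occurs (?r G))"
  note defs = this
  have 2: "f0 \<le> f1" "g0 \<le> g1"
    unfolding defs by (intro measure_pmf.finite_measure_mono occurs_remove, simp)+
  have eq: "{S. insert x S \<in> occurs F \<inter> occurs G} = occurs (?r F) \<inter> occurs (?r G)"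
    using insert_in_occurs[of x F] insert_in_occurs[of x G] by blast
  have "((1 - p) * f0 + p * f1) * ((1 - p) * g0 + p * g1) \<le>
      ((1 - p) * f0 + p * f1) * ((1 - p) * g0 + p * g1) + p * (1 - p) * ((f1 - f0) * (g1 - g0))"
    using 2 assms by simp
  also have "\<dots> = (1 - p) * (f0 * g0) + p * (f1 * g1)"
    by (simp add: algebra_simps)
  also have "\<dots> \<le> (1 - p) * ?P (occurs F \<inter> occurs G) + p * ?P (occurs (?r F) \<inter> occurs (?r G))"
    unfolding defs by (intro add_mono mult_left_mono insert.IH) (use assms in auto)
  finally show ?case
    using assms insert.hyps
    by (simp add: prob_random_subset_insert defs insert_in_occurs eq del: Int_iff)
qed

text \<open>Harris iterated over \<open>I\<close>; inclusion-exclusion carries positive correlation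
  over to the complements. This replaces independence, which fails because trails from different
  vertices can share edges.\<close>

lemma prob_not_occurs_UN_ge:
  assumes "finite X" "0 \<le> p" "p \<le> 1" "finite I"
  shows "(\<Prod>i\<in>I. 1 - measure_pmf.prob (random_subset X p) (occurs (F i))) \<le>
    1 - measure_pmf.prob (random_subset X p) (occurs (\<Union>i\<in>I. F i))"
  using assms(4)
proof (induction rule: finite_induct)
  case empty
  then show ?case by (simp add: occurs_def)
next
  case (insert i I)
  let ?P = "\<lambda>F. measure_pmf.prob (random_subset X p) F"
  let ?U = "\<Union>i\<in>I. F i"
  have "?P (occurs (F i \<union> ?U)) = ?P (occurs (F i)) + ?P (occurs ?U) - ?P (occurs (F i) \<inter> occurs ?U)"
    unfolding occurs_Un by (subst measure_Un3) (auto simp: measure_pmf.fmeasurable_eq_sets)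
  also have "\<dots> \<le> ?P (occurs (F i)) + ?P (occurs ?U) - ?P (occurs (F i)) * ?P (occurs ?U)"
    using harris_inequality[OF assms(1-3), of "F i" ?U] by simp
  finally have "(1 - ?P (occurs (F i))) * (1 - ?P (occurs ?U)) \<le> 1 - ?P (occurs (F i \<union> ?U))"
    by (simp add: algebra_simps)
  moreover have "(1 - ?P (occurs (F i))) * (\<Prod>i\<in>I. 1 - ?P (occurs (F i))) \<le>
      (1 - ?P (occurs (F i))) * (1 - ?P (occurs ?U))"
    by (intro mult_left_mono insert.IH) simp
  ultimately show ?case
    using insert.hyps by simp
qed

text \<open>Law of total variance: revealing \<open>x\<close> adds the variance
  \<open>p * (1 - p) * (b - a)\<^sup>2\<close> of the conditional mean, at most \<open>p\<close>
  because the conditional means \<open>a\<close> and \<open>b\<close> differ by at most 1.\<close>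

lemma variance_random_subset_le:
  fixes f :: "'a set \<Rightarrow> real"
  assumes "finite X" "0 \<le> p" "p \<le> 1"
    and "\<And>x S. \<bar>f (insert x S) - f S\<bar> \<le> 1"
  shows "measure_pmf.variance (random_subset X p) f \<le> real (card X) * p"
  using assms(1,4)
proof (induction X arbitrary: f rule: finite_induct)
  case empty
  then show ?case by (simp add: random_subset_empty)
next
  case (insert x X)
  let ?E = "\<lambda>f :: 'a set \<Rightarrow> real. measure_pmf.expectation (random_subset X p) f"
  define a b A B where "a = ?E f" "b = ?E (\<lambda>S. f (insert x S))"
    "A = ?E (\<lambda>S. (f S)\<^sup>2)" "B = ?E (\<lambda>S. (f (insert x S))\<^sup>2)"
  note defs = this
  note int = integrable_random_subset[OF insert.hyps(1)]
  have V: "measure_pmf.variance (random_subset Y p) f =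
      measure_pmf.expectation (random_subset Y p) (\<lambda>S. (f S)\<^sup>2) -
      (measure_pmf.expectation (random_subset Y p) f)\<^sup>2"
    if "finite Y" for f :: "'a set \<Rightarrow> real" and Y
    by (intro measure_pmf.variance_eq integrable_random_subset that)
  have 1: "A - a\<^sup>2 \<le> real (card X) * p"
    using insert.IH[of f] insert.prems unfolding V[OF insert.hyps(1)] defs by blast
  have 2: "B - b\<^sup>2 \<le> real (card X) * p"
    using insert.IH[of "\<lambda>S. f (insert x S)"] insert.prems
    unfolding V[OF insert.hyps(1)] defs by (metis insert_commute)
  have "\<bar>b - a\<bar> = \<bar>?E (\<lambda>S. f (insert x S) - f S)\<bar>"
    by (simp add: defs int)
  also have "\<dots> \<le> ?E (\<lambda>S. \<bar>f (insert x S) - f S\<bar>)"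
    by (rule integral_abs_bound)
  also have "\<dots> \<le> ?E (\<lambda>_. 1)"
    by (intro integral_mono int insert.prems)
  finally have "\<bar>b - a\<bar> \<le> 1" by simp
  then have 3: "(b - a)\<^sup>2 \<le> 1"
    by (simp add: abs_square_le_1)
  have "(1 - p) * A + p * B - ((1 - p) * a + p * b)\<^sup>2 =
      (1 - p) * (A - a\<^sup>2) + p * (B - b\<^sup>2) + p * (1 - p) * (b - a)\<^sup>2"
    by (simp add: algebra_simps power2_eq_square)
  also have "\<dots> \<le> (1 - p) * (real (card X) * p) + p * (real (card X) * p) + p * 1 * 1"
    using assms(2,3) by (intro add_mono mult_left_mono mult_mono 1 2 3) auto
  also have "\<dots> = real (card (insert x X)) * p"
    using insert.hyps by (simp add: algebra_simps)
  finally show ?case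
    using insert.hyps assms(2,3)
    by (subst V) (simp_all add: expectation_random_subset_insert defs)
qed

section \<open>Trails and bridges\<close>

text \<open>A trail is recorded as its set of edges. Edges may not repeat but vertices may: this is
  exactly what makes the first edge and the remaining trail occur disjointly.\<close>

fun trails :: "'a set set \<Rightarrow> nat \<Rightarrow> 'a \<Rightarrow> 'a set set set" where
  "trails X 0 v = {{}}"
| "trails X (Suc k) v =
    (\<Union>e\<in>{e\<in>X. v \<in> e}. disjoint_unions {{e}} (\<Union>u\<in>e - {v}. trails X k u))"

lemma trails_SucI:
  assumes "e \<in> X" "v \<in> e" "u \<in> e" "u \<noteq> v" "b \<in> trails X k u" "e \<notin> b"
  shows "insert e b \<in> trails X (Suc k) v"
proof -
  have "insert e b \<in> disjoint_unions {{e}} (\<Union>u\<in>e - {v}. trails X k u)"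
    unfolding disjoint_unions_def using assms by blast
  then show ?thesis using assms by auto
qed

text \<open>\<open>d\<close> is the unordered pair of exit vertices; \<open>Min\<close> and
  \<open>Max\<close> merely name its two elements, so that no pair is counted twice in the union
  bound.\<close>

definition bridges :: "'a::linorder set set \<Rightarrow> nat \<Rightarrow> 'a set \<Rightarrow> 'a set set set" where
  "bridges X k e = (\<Union>d\<in>{d. d \<subseteq> e \<and> card d = 2}.
     disjoint_unions {{e}} (disjoint_unions (trails X k (Min d)) (trails X k (Max d))))"

lemma bridgesI:
  assumes "u \<in> e" "w \<in> e" "u \<noteq> w" "a \<in> trails X k u" "b \<in> trails X k w"
    "a \<inter> b = {}" "e \<notin> a" "e \<notin> b"
  shows "insert e (a \<union> b) \<in> bridges X k e"
proof -
  have *: "insert e (a \<union> b) \<in> bridges X k e"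
    if "u \<in> e" "w \<in> e" "u < w" "a \<in> trails X k u" "b \<in> trails X k w"
      "a \<inter> b = {}" "e \<notin> a" "e \<notin> b" for u w a b
  proof -
    have "a \<union> b \<in> disjoint_unions (trails X k (Min {u, w})) (trails X k (Max {u, w}))"
      unfolding disjoint_unions_def using that by auto
    then have "insert e (a \<union> b) \<in> disjoint_unions {{e}}
        (disjoint_unions (trails X k (Min {u, w})) (trails X k (Max {u, w})))"
      using that unfolding disjoint_unions_def[of "{{e}}"] by blast
    moreover have "{u, w} \<subseteq> e" "card {u, w} = 2" using that by auto
    ultimately show ?thesis unfolding bridges_def by blast
  qed
  show ?thesis
  proof (cases "u < w")
    case True
    then show ?thesis using *[of u w a b] assms by blast
  next
    case False
    then have "w < u" using assms by auto
    then show ?thesis using *[of w u b a] assms by (simp add: Un_commute Int_commute)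
  qed
qed

section \<open>Probability that a trail of given length leaves a vertex\<close>

lemma prob_mem_random_subset_le:
  assumes "finite X" "0 \<le> p" "p \<le> 1"
  shows "measure_pmf.prob (random_subset X p) (occurs {{e}}) \<le> p"
proof (cases "e \<in> X")
  case True
  have "measure_pmf.prob (random_subset (X - {e}) p) (occurs {{e}}) = 0"
    using set_random_subset[of "X - {e}" p] assms
    by (subst measure_pmf_zero_iff) (auto simp: occurs_def)
  moreover have "measure_pmf.prob (random_subset (X - {e}) p) {S. insert e S \<in> occurs {{e}}} = 1"
    by (simp add: occurs_def)
  ultimately show ?thesis
    using prob_random_subset_insert[of "X - {e}" e p "occurs {{e}}"] assms True
    by (simp add: insert_absorb)
next
  case False
  then have "measure_pmf.prob (random_subset X p) (occurs {{e}}) = 0"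
    using set_random_subset[of X p] assms
    by (subst measure_pmf_zero_iff) (auto simp: occurs_def)
  then show ?thesis using assms by simp
qed

lemma prob_occurs_singleton_disjoint_unions_le:
  assumes "finite X" "0 \<le> p" "p \<le> 1/2"
    and "measure_pmf.prob (random_subset X p) (occurs F) \<le> q"
  shows "measure_pmf.prob (random_subset X p) (occurs (disjoint_unions {{e}} F)) \<le> p * q"
proof -
  have "measure_pmf.prob (random_subset X p) (occurs (disjoint_unions {{e}} F)) \<le>
    measure_pmf.prob (random_subset X p) (occurs {{e}}) *
    measure_pmf.prob (random_subset X p) (occurs F)"
    by (rule prob_disjoint_unions_le[OF assms(1-3)])
  also have "\<dots> \<le> p * q"
    using assms by (intro mult_mono prob_mem_random_subset_le) auto
  finally show ?thesis .
qed

lemma card_subsets_containing: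
  assumes "finite V" "v \<in> V" "1 \<le> r"
  shows "card {e \<in> {e. e \<subseteq> V \<and> card e = r}. v \<in> e} = (card V - 1) choose (r - 1)"
proof -
  have "bij_betw (insert v) {d. d \<subseteq> V - {v} \<and> card d = r - 1}
      {e \<in> {e. e \<subseteq> V \<and> card e = r}. v \<in> e}"
  proof (rule bij_betw_byWitness[where f' = "\<lambda>e. e - {v}"])
    show "insert v ` {d. d \<subseteq> V - {v} \<and> card d = r - 1} \<subseteq> {e \<in> {e. e \<subseteq> V \<and> card e = r}. v \<in> e}"
    proof (rule image_subsetI)
      fix d assume "d \<in> {d. d \<subseteq> V - {v} \<and> card d = r - 1}"
      then have d: "d \<subseteq> V - {v}" "card d = r - 1" by auto
      then have "finite d" "v \<notin> d" using assms by (auto intro: finite_subset)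
      then show "insert v d \<in> {e \<in> {e. e \<subseteq> V \<and> card e = r}. v \<in> e}"
        using d assms by auto
    qed
  qed auto
  then have "card {e \<in> {e. e \<subseteq> V \<and> card e = r}. v \<in> e} =
      card {d. d \<subseteq> V - {v} \<and> card d = r - 1}"
    by (simp add: bij_betw_same_card)
  also have "\<dots> = (card V - 1) choose (r - 1)"
    using assms by (subst n_subsets) auto
  finally show ?thesis .
qed

text \<open>One generation of the branching process. Harris treats the \<open>r - 1\<close> other
  vertices of an edge, van den Berg-Kesten decouples the edge from its continuation, and Harris
  again combines the edges at \<open>v\<close>. All three err in the same direction.\<close>

lemma prob_not_trails_Suc_ge:
  fixes V :: "'a set" and r :: nat
  defines "X \<equiv> {e. e \<subseteq> V \<and> card e = r}"
  assumes "finite V" "v \<in> V" "1 \<le> r" "0 \<le> p" "p \<le> 1/2"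
    and q: "\<And>u. u \<in> V \<Longrightarrow> measure_pmf.prob (random_subset X p) (occurs (trails X k u)) \<le> q"
    and "q \<le> 1"
  shows "(1 - p * (1 - (1 - q) ^ (r - 1))) ^ ((card V - 1) choose (r - 1)) \<le>
    1 - measure_pmf.prob (random_subset X p) (occurs (trails X (Suc k) v))"
proof -
  let ?P = "measure_pmf.prob (random_subset X p)"
  have fin: "finite X" unfolding X_def using assms by simp
  have e: "1 - p * (1 - (1 - q) ^ (r - 1)) \<le>
      1 - ?P (occurs (disjoint_unions {{e}} (\<Union>u\<in>e - {v}. trails X k u)))"
    if "e \<in> {e\<in>X. v \<in> e}" for e
  proof -
    have e: "e \<subseteq> V" "card e = r" "v \<in> e" "finite e"
      using that assms by (auto simp: X_def intro: finite_subset)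
    have "(1 - q) ^ (r - 1) = (\<Prod>u\<in>e - {v}. 1 - q)"
      using e by simp
    also have "\<dots> \<le> (\<Prod>u\<in>e - {v}. 1 - ?P (occurs (trails X k u)))"
      using e q assms(8) by (intro prod_mono) auto
    also have "\<dots> \<le> 1 - ?P (occurs (\<Union>u\<in>e - {v}. trails X k u))"
      using assms e fin by (intro prob_not_occurs_UN_ge) auto
    finally have "?P (occurs (\<Union>u\<in>e - {v}. trails X k u)) \<le> 1 - (1 - q) ^ (r - 1)" by simp
    from prob_occurs_singleton_disjoint_unions_le[OF fin assms(5,6) this]
    show ?thesis by simp
  qed
  have "0 \<le> q"
    using q[OF assms(3)] measure_nonneg order_trans by blast
  then have "(1 - q) ^ (r - 1) \<le> 1" "0 \<le> (1 - q) ^ (r - 1)"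
    using assms(8) by (auto intro: power_le_one)
  \<comment> \<open>This keeps the factors nonnegative, as the monotonicity of the product
    requires.\<close>
  then have "p * (1 - (1 - q) ^ (r - 1)) \<le> 1/2 * 1"
    using assms by (intro mult_mono) auto
  then have "(\<Prod>e\<in>{e\<in>X. v \<in> e}. 1 - p * (1 - (1 - q) ^ (r - 1))) \<le>
      (\<Prod>e\<in>{e\<in>X. v \<in> e}. 1 - ?P (occurs (disjoint_unions {{e}} (\<Union>u\<in>e - {v}. trails X k u))))"
    using e by (intro prod_mono) auto
  also have "\<dots> \<le> 1 - ?P (occurs (trails X (Suc k) v))"
    unfolding trails.simps using assms fin by (intro prob_not_occurs_UN_ge) auto
  finally show ?thesis
    using card_subsets_containing[OF assms(2-4)] by (simp add: X_def)
qed

text \<open>Upper bounds for \<open>- m * ln (1 - Q\<^bsub>k+1\<^esub>)\<close>: in terms of these exponents the recursion becomes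
  that of a Poisson branching process with mean \<open>c\<close>, whatever the value of \<open>r\<close>.\<close>

fun extinction_exponent :: "real \<Rightarrow> nat \<Rightarrow> real" where
  "extinction_exponent c 0 = c"
| "extinction_exponent c (Suc k) = c * (1 - exp (- extinction_exponent c k))"

lemma extinction_exponent_nonneg: "0 \<le> c \<Longrightarrow> 0 \<le> extinction_exponent c k"
  by (induction k) auto

text \<open>From \<open>ln (1 - x) \<ge> - x - 2 * x\<^sup>2\<close> on [0, 1/2]; since
  \<open>y\<^sup>2 \<le> y\<close>, the quadratic term only multiplies the mean by
  \<open>1 + 2 * p\<close>.\<close>

lemma power_one_minus_ge_exp:
  fixes p y c :: real
  assumes "0 \<le> p" "p \<le> 1/2" "0 \<le> y" "y \<le> z" "z \<le> 1" "real N * p * (1 + 2 * p) \<le> c"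
  shows "exp (- c * z) \<le> (1 - p * y) ^ N"
proof -
  have py: "0 \<le> p * y" "p * y \<le> 1/2"
    using assms mult_mono[of p "1/2" y 1] by auto
  have "y\<^sup>2 \<le> y" using assms by (simp add: power2_eq_square mult_left_le)
  then have "p * y + 2 * (p * y)\<^sup>2 \<le> p * y + 2 * (p\<^sup>2 * y)"
    by (simp add: power_mult_distrib mult_left_mono)
  then have "real N * (p * y + 2 * (p * y)\<^sup>2) \<le> real N * (p * y + 2 * (p\<^sup>2 * y))"
    by (intro mult_left_mono) auto
  also have "\<dots> = real N * p * (1 + 2 * p) * y"
    by (simp add: power2_eq_square algebra_simps)
  also have "\<dots> \<le> c * z"
    using assms by (intro mult_mono) (auto intro: order_trans[rotated])
  finally have "- c * z \<le> real N * (- (p * y) - 2 * (p * y)\<^sup>2)"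
    by (simp add: algebra_simps)
  also have "\<dots> \<le> real N * ln (1 - p * y)"
    using py by (intro mult_left_mono ln_one_minus_pos_lower_bound) auto
  finally have "exp (- c * z) \<le> exp (real N * ln (1 - p * y))" by simp
  also have "\<dots> = (1 - p * y) ^ N"
    using py by (simp add: exp_of_nat_mult)
  finally show ?thesis .
qed

lemma prob_not_trails_ge:
  fixes V :: "'a set" and r :: nat
  defines "X \<equiv> {e. e \<subseteq> V \<and> card e = r}"
  assumes "finite V" "v \<in> V" "2 \<le> r" "0 \<le> p" "p \<le> 1/2"
    and c: "real (r - 1) * (real ((card V - 1) choose (r - 1)) * p * (1 + 2 * p)) \<le> c"
  shows "exp (- (extinction_exponent c k / real (r - 1))) \<le>
    1 - measure_pmf.prob (random_subset X p) (occurs (trails X (Suc k) v))"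
  using assms(3)
proof (induction k arbitrary: v)
  case 0
  \<comment> \<open>Trails of length 0 always occur, so the recursion starts from
    \<open>q = 1\<close>; hence the shift between \<open>k\<close> and \<open>Suc k\<close>.\<close>
  have "(1 - p * (1 - (1 - 1) ^ (r - 1))) ^ ((card V - 1) choose (r - 1)) \<le>
      1 - measure_pmf.prob (random_subset X p) (occurs (trails X (Suc 0) v))"
    unfolding X_def using assms 0 by (intro prob_not_trails_Suc_ge) auto
  moreover have "exp (- (c / real (r - 1)) * 1) \<le>
      (1 - p * (1 - (1 - 1) ^ (r - 1))) ^ ((card V - 1) choose (r - 1))"
    using assms by (intro power_one_minus_ge_exp) (auto simp: field_simps power_0_left)
  ultimately show ?case by simp
next
  case (Suc k)
  let ?t = "extinction_exponent c k"
  have "0 \<le> real (r - 1) * (real ((card V - 1) choose (r - 1)) * p * (1 + 2 * p))"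
    using assms by simp
  then have c0: "0 \<le> c" using c by linarith
  then have t0: "0 \<le> ?t" by (rule extinction_exponent_nonneg)
  \<comment> \<open>With this \<open>q\<close>, \<open>(1 - q) ^ (r - 1)\<close> equals
    \<open>exp (- ?t)\<close>, and \<open>r\<close> disappears from the recursion.\<close>
  define q where "q = 1 - exp (- (?t / real (r - 1)))"
  have q: "0 \<le> q" "q \<le> 1" using t0 by (auto simp: q_def)
  have pow: "(1 - q) ^ (r - 1) = exp (- ?t)"
    using assms(4) by (simp add: q_def flip: exp_of_nat_mult)
  have "(1 - p * (1 - (1 - q) ^ (r - 1))) ^ ((card V - 1) choose (r - 1)) \<le>
      1 - measure_pmf.prob (random_subset X p) (occurs (trails X (Suc (Suc k)) v))"
    unfolding X_def
  proof (rule prob_not_trails_Suc_ge)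
    fix u assume "u \<in> V"
    from Suc.IH[OF this] show "measure_pmf.prob (random_subset {e. e \<subseteq> V \<and> card e = r} p)
        (occurs (trails {e. e \<subseteq> V \<and> card e = r} (Suc k) u)) \<le> q"
      by (simp add: q_def X_def)
  qed (use assms Suc.prems q in auto)
  moreover have "exp (- (c / real (r - 1)) * (1 - exp (- ?t))) \<le>
      (1 - p * (1 - exp (- ?t))) ^ ((card V - 1) choose (r - 1))"
    using assms t0 by (intro power_one_minus_ge_exp) (auto simp: field_simps)
  ultimately show ?case
    unfolding pow by simp
qed

section \<open>Survival exponent of a slightly supercritical branching process\<close>

text \<open>The recursion map is increasing and its first step, from \<open>c\<close>, goes
  down.\<close>

lemma decseq_extinction_exponent:
  assumes "0 \<le> c"
  shows "decseq (extinction_exponent c)"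
proof (rule decseq_SucI)
  fix k
  show "extinction_exponent c (Suc k) \<le> extinction_exponent c k"
  proof (induction k)
    case 0
    then show ?case using assms by (simp add: mult_left_le)
  next
    case (Suc k)
    then show ?case using assms by (auto intro!: mult_left_mono)
  qed
qed

text \<open>Taylor bounds of alternating direction, each obtained from the sign of a derivative that
  the previous one controls.\<close>

lemma exp_minus_ge_cubic:
  fixes x :: real
  assumes "0 \<le> x"
  shows "1 - x + x\<^sup>2 / 2 - x ^ 3 / 6 \<le> exp (- x)"
proof -
  let ?f = "\<lambda>x :: real. exp (- x) - (1 - x + x\<^sup>2 / 2 - x ^ 3 / 6)"
  have 1: "- (exp (- x)) \<le> - (1 - x)" for x :: real
    using exp_ge_add_one_self[of "- x"] by simp
  have 2: "exp (- x) \<le> 1 - x + x\<^sup>2 / 2" if "0 \<le> x" for x :: real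
  proof -
    let ?g = "\<lambda>x :: real. exp (- x) - (1 - x + x\<^sup>2 / 2)"
    have "?g x \<le> ?g 0"
    proof (rule DERIV_nonpos_imp_nonincreasing[OF that])
      fix y :: real
      have "(?g has_real_derivative (1 - y) - exp (- y)) (at y)"
        by (auto intro!: derivative_eq_intros)
      then show "\<exists>z. (?g has_real_derivative z) (at y) \<and> z \<le> 0"
        using 1[of y] by auto
    qed
    then show ?thesis by simp
  qed
  have "?f 0 \<le> ?f x"
  proof (rule DERIV_nonneg_imp_nondecreasing[OF assms])
    fix y :: real assume "0 \<le> y" "y \<le> x"
    have "(?f has_real_derivative (1 - y + y\<^sup>2 / 2) - exp (- y)) (at y)"
      by (auto intro!: derivative_eq_intros simp: power2_eq_square)
    then show "\<exists>z. (?f has_real_derivative z) (at y) \<and> 0 \<le> z"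
      using 2[OF \<open>0 \<le> y\<close>] by auto
  qed
  then show ?thesis by simp
qed

text \<open>The cubic Taylor bound divided by \<open>L\<close> gives
  \<open>L / 2 - L\<^sup>2 / 6 \<le> \<delta>\<close>. The coarse consequence
  \<open>L \<le> 4 * \<delta>\<close> is then put into the quadratic term, and 16/3 arises as 4 * 4
  / 3.\<close>

lemma extinction_exponent_fixed_point_le:
  fixes \<delta> L :: real
  assumes "0 < \<delta>" "\<delta> \<le> 1/2" "0 \<le> L" "L \<le> 3/2" "L = (1 + \<delta>) * (1 - exp (- L))"
  shows "L \<le> 2 * \<delta> + 16/3 * \<delta>\<^sup>2"
proof (cases "L = 0")
  case True
  then show ?thesis using assms by simp
next
  case False
  then have L: "0 < L" using assms by simp
  have "L \<le> (1 + \<delta>) * (L - L\<^sup>2 / 2 + L ^ 3 / 6)"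
    using exp_minus_ge_cubic[of L] assms by (subst assms(5)) (intro mult_left_mono, auto)
  also have "\<dots> = L * ((1 + \<delta>) * (1 - L / 2 + L\<^sup>2 / 6))"
    by (simp add: algebra_simps power2_eq_square power3_eq_cube)
  finally have "1 \<le> (1 + \<delta>) * (1 - L / 2 + L\<^sup>2 / 6)"
    using L by simp
  then have "(1 + \<delta>) * (L / 2 - L\<^sup>2 / 6) \<le> \<delta>"
    by (simp add: algebra_simps)
  moreover have LL: "L\<^sup>2 / 6 \<le> L / 4"
    using L assms by (simp add: power2_eq_square)
  then have "1 * (L / 2 - L\<^sup>2 / 6) \<le> (1 + \<delta>) * (L / 2 - L\<^sup>2 / 6)"
    using assms L by (intro mult_right_mono) auto
  ultimately have *: "L / 2 - L\<^sup>2 / 6 \<le> \<delta>" by simp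
  then have "L \<le> 4 * \<delta>" using LL by simp
  then have "L\<^sup>2 \<le> (4 * \<delta>)\<^sup>2" using L by (intro power_mono) auto
  then show ?thesis using * by (simp add: power_mult_distrib)
qed

text \<open>The decreasing exponents tend to a fixed point, itself at most the first term
  \<open>1 + \<delta>\<close>. The slack between 16/3 and 6 lets a finite \<open>k\<close> reach the
  bound.\<close>

lemma extinction_exponent_eventually_small:
  assumes "0 < \<delta>" "\<delta> \<le> 1/2"
  shows "\<exists>k. extinction_exponent (1 + \<delta>) k \<le> 2 * \<delta> + 6 * \<delta>\<^sup>2"
proof -
  let ?t = "extinction_exponent (1 + \<delta>)"
  have nn: "0 \<le> ?t k" for k by (rule extinction_exponent_nonneg) (use assms in auto)
  have dec: "decseq ?t" by (rule decseq_extinction_exponent) (use assms in auto)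
  obtain L where L: "?t \<longlonglongrightarrow> L" "\<And>i. L \<le> ?t i"
    using decseq_convergent[OF dec, of 0] nn by blast
  have "(\<lambda>k. ?t (Suc k)) \<longlonglongrightarrow> (1 + \<delta>) * (1 - exp (- L))"
    unfolding extinction_exponent.simps by (intro tendsto_intros L)
  then have fp: "L = (1 + \<delta>) * (1 - exp (- L))"
    using LIMSEQ_unique LIMSEQ_Suc[OF L(1)] by blast
  have "0 \<le> L" using L(1) nn by (meson LIMSEQ_le_const)
  moreover have "L \<le> 3/2" using L(2)[of 0] assms by simp
  ultimately have "L \<le> 2 * \<delta> + 16/3 * \<delta>\<^sup>2"
    using extinction_exponent_fixed_point_le[OF assms _ _ fp] by simp
  also have "\<dots> < 2 * \<delta> + 6 * \<delta>\<^sup>2" using assms by simp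
  finally have "eventually (\<lambda>k. ?t k < 2 * \<delta> + 6 * \<delta>\<^sup>2) sequentially"
    using L(1) by (simp add: order_tendstoD)
  then show ?thesis
    by (metis eventually_sequentially le_refl less_imp_le)
qed

text \<open>Union bound over the pairs of exit vertices; van den Berg-Kesten separates the two
  trails from each other and both from \<open>e\<close>.\<close>

lemma prob_bridges_le:
  fixes V :: "'a::linorder set" and r :: nat
  defines "X \<equiv> {e. e \<subseteq> V \<and> card e = r}"
  assumes "finite V" "0 \<le> p" "p \<le> 1/2" "e \<in> X"
    and q: "\<And>u. u \<in> V \<Longrightarrow> measure_pmf.prob (random_subset X p) (occurs (trails X k u)) \<le> q"
    and "0 \<le> q"
  shows "measure_pmf.prob (random_subset X p) (occurs (bridges X k e)) \<le>
    real (r choose 2) * (p * q\<^sup>2)"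
proof -
  let ?P = "measure_pmf.prob (random_subset X p)"
  let ?D = "{d. d \<subseteq> e \<and> card d = 2}"
  let ?F = "\<lambda>d. disjoint_unions (trails X k (Min d)) (trails X k (Max d))"
  have e: "e \<subseteq> V" "card e = r" "finite e"
    using assms by (auto intro: finite_subset)
  have fin: "finite X" unfolding X_def using assms by simp
  have "?P (occurs (bridges X k e)) = ?P (\<Union>d\<in>?D. occurs (disjoint_unions {{e}} (?F d)))"
    unfolding bridges_def by (intro arg_cong[where f = ?P]) (auto simp: occurs_def)
  also have "\<dots> \<le> (\<Sum>d\<in>?D. ?P (occurs (disjoint_unions {{e}} (?F d))))"
    using e by (intro measure_pmf.finite_measure_subadditive_finite) auto
  also have "\<dots> \<le> (\<Sum>d\<in>?D. p * q\<^sup>2)"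
  proof (intro sum_mono prob_occurs_singleton_disjoint_unions_le)
    fix d assume "d \<in> ?D"
    then have d: "d \<subseteq> e" "card d = 2" by auto
    then have "finite d" "d \<noteq> {}" using e by (auto intro: finite_subset)
    then have "Min d \<in> V" "Max d \<in> V"
      using d e by (meson Min_in Max_in subsetD)+
    have "?P (occurs (?F d)) \<le> ?P (occurs (trails X k (Min d))) * ?P (occurs (trails X k (Max d)))"
      using assms fin by (intro prob_disjoint_unions_le) auto
    also have "\<dots> \<le> q * q"
      using \<open>Min d \<in> V\<close> \<open>Max d \<in> V\<close> assms(7) by (intro mult_mono q) auto
    finally show "?P (occurs (?F d)) \<le> q\<^sup>2" by (simp add: power2_eq_square)
  qed (use fin assms in auto)
  also have "\<dots> = real (r choose 2) * (p * q\<^sup>2)"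
    using e by (simp add: n_subsets)
  finally show ?thesis .
qed

section \<open>Packings of edge sets\<close>

lemma occurs_mono: "S \<in> occurs F \<Longrightarrow> S \<subseteq> S' \<Longrightarrow> S' \<in> occurs F"
  unfolding occurs_def by blast

text \<open>The number of bridges itself is not Lipschitz under insertion of an edge; this quantity is.\<close>

definition packing_number :: "'a set set \<Rightarrow> 'a set \<Rightarrow> nat" where
  "packing_number T S = Max (card ` {D. D \<subseteq> T \<and> disjoint D \<and> \<Union>D \<subseteq> S})"

lemma packing_number_ge:
  assumes "finite T" "D \<subseteq> T" "disjoint D" "\<Union>D \<subseteq> S"
  shows "card D \<le> packing_number T S"
  unfolding packing_number_def using assms by (intro Max_ge) auto

lemma packing_number_attained:
  assumes "finite T"
  obtains D where "D \<subseteq> T" "disjoint D" "\<Union>D \<subseteq> S" "card D = packing_number T S"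
proof -
  have "{} \<in> {D. D \<subseteq> T \<and> disjoint D \<and> \<Union>D \<subseteq> S}" by simp
  then have "packing_number T S \<in> card ` {D. D \<subseteq> T \<and> disjoint D \<and> \<Union>D \<subseteq> S}"
    unfolding packing_number_def using assms by (intro Max_in) (auto simp: image_def)
  then show ?thesis using that by force
qed

text \<open>At most one member of a disjoint family contains \<open>x\<close>; discarding it leaves
  a packing of \<open>S\<close>.\<close>

lemma packing_number_insert:
  assumes "finite T"
  shows "\<bar>real (packing_number T (insert x S)) - real (packing_number T S)\<bar> \<le> 1"
proof -
  obtain D where D: "D \<subseteq> T" "disjoint D" "\<Union>D \<subseteq> S" "card D = packing_number T S"
    using packing_number_attained[OF assms] .
  have "card D \<le> packing_number T (insert x S)"
    using D assms by (intro packing_number_ge) auto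
  moreover obtain D' where D': "D' \<subseteq> T" "disjoint D'" "\<Union>D' \<subseteq> insert x S"
    "card D' = packing_number T (insert x S)"
    using packing_number_attained[OF assms] .
  have fin: "finite D'" using D'(1) assms by (rule finite_subset)
  have "card {C\<in>D'. x \<notin> C} \<le> packing_number T S"
    using D' assms by (intro packing_number_ge) (auto simp: disjoint_def)
  moreover have "card {C\<in>D'. x \<in> C} \<le> 1"
  proof (subst One_nat_def, rule card_le_Suc0_iff_eq[THEN iffD2])
    show "\<forall>a1\<in>{C\<in>D'. x \<in> C}. \<forall>a2\<in>{C\<in>D'. x \<in> C}. a1 = a2"
      using D'(2) by (auto simp: disjoint_def)
  qed (use fin in auto)
  moreover have "card D' = card {C\<in>D'. x \<notin> C} + card {C\<in>D'. x \<in> C}"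
    using fin by (subst card_Un_disjoint[symmetric]) (auto intro!: arg_cong[where f = card])
  ultimately show ?thesis using D(4) D'(4) by linarith
qed

text \<open>The edges counted in different members of a packing are different, and their events
  still occur in \<open>S\<close> by monotonicity. Thus the packing number inherits the first moment
  bound for bridges.\<close>

lemma packing_number_le_card_occurring:
  assumes "finite X" "T \<subseteq> Pow X"
    and "\<And>C. C \<in> T \<Longrightarrow> m \<le> card {e\<in>C. C \<in> occurs (B e)}"
  shows "m * packing_number T S \<le> card {e\<in>X. S \<in> occurs (B e)}"
proof -
  have "finite T" using assms by (meson finite_Pow_iff finite_subset)
  then obtain D where D: "D \<subseteq> T" "disjoint D" "\<Union>D \<subseteq> S" "card D = packing_number T S"
    by (rule packing_number_attained)
  have fin: "finite D" "\<And>C. C \<in> D \<Longrightarrow> finite C"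
    using D \<open>finite T\<close> assms(1,2) by (meson PowD finite_subset subsetD)+
  have "m * packing_number T S = (\<Sum>C\<in>D. m)" using D by simp
  also have "\<dots> \<le> (\<Sum>C\<in>D. card {e\<in>C. C \<in> occurs (B e)})"
    using D assms by (intro sum_mono) auto
  also have "\<dots> = card (\<Union>C\<in>D. {e\<in>C. C \<in> occurs (B e)})"
    using fin D(2) by (intro card_UN_disjoint[symmetric]) (auto simp: disjoint_def)
  also have "\<dots> \<le> card {e\<in>X. S \<in> occurs (B e)}"
  proof (intro card_mono)
    show "(\<Union>C\<in>D. {e\<in>C. C \<in> occurs (B e)}) \<subseteq> {e\<in>X. S \<in> occurs (B e)}"
    proof (rule subsetI, elim UN_E CollectE conjE, intro CollectI conjI)
      fix e C assume C: "C \<in> D" "e \<in> C" "C \<in> occurs (B e)"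
      show "e \<in> X" using C D(1) assms(2) by blast
      have "C \<subseteq> S" using C D(3) by blast
      then show "S \<in> occurs (B e)" using C(3) by (rule occurs_mono[rotated])
    qed
  qed (use assms in auto)
  finally show ?thesis .
qed

lemma expectation_packing_number_le:
  assumes "finite X" "T \<subseteq> Pow X"
    and "\<And>C. C \<in> T \<Longrightarrow> m \<le> card {e\<in>C. C \<in> occurs (B e)}"
    and "\<And>e. e \<in> X \<Longrightarrow> measure_pmf.prob (random_subset X p) (occurs (B e)) \<le> b"
  shows "real m * measure_pmf.expectation (random_subset X p) (\<lambda>S. real (packing_number T S)) \<le>
    real (card X) * b"
proof -
  let ?E = "\<lambda>f :: 'a set \<Rightarrow> real. measure_pmf.expectation (random_subset X p) f"
  note int = integrable_random_subset[OF assms(1)]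
  have "real m * ?E (\<lambda>S. real (packing_number T S)) = ?E (\<lambda>S. real m * real (packing_number T S))"
    by simp
  also have "\<dots> \<le> ?E (\<lambda>S. \<Sum>e\<in>X. indicator (occurs (B e)) S)"
  proof (intro integral_mono int)
    fix S
    have "real (card {e\<in>X. S \<in> occurs (B e)}) = (\<Sum>e\<in>X. indicator (occurs (B e)) S)"
      using assms(1) by (simp add: indicator_def sum.If_cases Int_def)
    moreover have "m * packing_number T S \<le> card {e\<in>X. S \<in> occurs (B e)}"
      using assms(1-3) by (rule packing_number_le_card_occurring)
    then have "real m * real (packing_number T S) \<le> real (card {e\<in>X. S \<in> occurs (B e)})"
      by (simp flip: of_nat_mult)
    ultimately show "real m * real (packing_number T S) \<le> (\<Sum>e\<in>X. indicator (occurs (B e)) S)"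
      by simp
  qed
  also have "\<dots> = (\<Sum>e\<in>X. measure_pmf.prob (random_subset X p) (occurs (B e)))"
    by (simp add: Bochner_Integration.integral_sum[OF int])
  also have "\<dots> \<le> real (card X) * b"
    using assms(4) by (intro sum_bounded_above) auto
  finally show ?thesis .
qed

text \<open>Chebyshev's inequality: the first moment bounds the mean, and the Lipschitz property
  bounds the variance by \<open>real (card X) * p\<close>.\<close>

lemma prob_packing_number_large:
  assumes "finite X" "T \<subseteq> Pow X" "0 \<le> p" "p \<le> 1" "0 < m" "0 < a"
    and "\<And>C. C \<in> T \<Longrightarrow> m \<le> card {e\<in>C. C \<in> occurs (B e)}"
    and "\<And>e. e \<in> X \<Longrightarrow> measure_pmf.prob (random_subset X p) (occurs (B e)) \<le> b"
  shows "measure_pmf.prob (random_subset X p)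
      {S. real (card X) * b / real m + a \<le> real (packing_number T S)} \<le> real (card X) * p / a\<^sup>2"
proof -
  let ?f = "\<lambda>S. real (packing_number T S)"
  let ?R = "random_subset X p"
  have "finite T" using assms by (meson finite_Pow_iff finite_subset)
  have "measure_pmf.expectation ?R ?f \<le> real (card X) * b / real m"
    using expectation_packing_number_le[OF assms(1,2,7,8)] assms(5)
    by (simp add: field_simps)
  then have "measure_pmf.prob ?R {S. real (card X) * b / real m + a \<le> ?f S} \<le>
      measure_pmf.prob ?R {S\<in>space ?R. a \<le> \<bar>?f S - measure_pmf.expectation ?R ?f\<bar>}"
    by (intro measure_pmf.finite_measure_mono) auto
  also have "\<dots> \<le> measure_pmf.variance ?R ?f / a\<^sup>2"
    using assms by (intro measure_pmf.Chebyshev_inequality integrable_random_subset) auto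
  also have "\<dots> \<le> real (card X) * p / a\<^sup>2"
    using assms packing_number_insert[OF \<open>finite T\<close>]
    by (intro divide_right_mono variance_random_subset_le) auto
  finally show ?thesis .
qed

section \<open>Loose paths\<close>

text \<open>Retains only the joints and edges of a loose path: \<open>e i\<close> leads from
  \<open>x (i - 1)\<close> to \<open>x i\<close>, so joints are numbered from 0 and edges from
  1.\<close>

definition edge_walk :: "'a set set \<Rightarrow> nat \<Rightarrow> (nat \<Rightarrow> 'a) \<Rightarrow> (nat \<Rightarrow> 'a set) \<Rightarrow> bool" where
  "edge_walk X l x e \<longleftrightarrow> inj_on e {1..l} \<and>
     (\<forall>i\<in>{1..l}. e i \<in> X \<and> x (i - 1) \<in> e i \<and> x i \<in> e i \<and> x (i - 1) \<noteq> x i)"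

lemma edge_walk_trail_forward:
  assumes "edge_walk X l x e" "i + k \<le> l"
  shows "e ` {i + 1..i + k} \<in> trails X k (x i)"
  using assms(2)
proof (induction k arbitrary: i)
  case 0
  then show ?case by simp
next
  case (Suc k)
  have "i + 1 \<in> {1..l}" using Suc.prems by auto
  then have e: "e (i + 1) \<in> X" "x i \<in> e (i + 1)" "x (i + 1) \<in> e (i + 1)" "x i \<noteq> x (i + 1)"
    using assms(1) unfolding edge_walk_def by (metis add_diff_cancel_right')+
  have IH: "e ` {i + 1 + 1..i + 1 + k} \<in> trails X k (x (i + 1))"
    using Suc.IH[of "i + 1"] Suc.prems by simp
  have "e (i + 1) \<notin> e ` {i + 1 + 1..i + 1 + k}"
    using assms(1) Suc.prems unfolding edge_walk_def
    by (subst inj_on_image_mem_iff[where B = "{1..l}"]) auto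
  then have "insert (e (i + 1)) (e ` {i + 1 + 1..i + 1 + k}) \<in> trails X (Suc k) (x i)"
    using e IH by (intro trails_SucI) auto
  moreover have "{i + 1..i + Suc k} = insert (i + 1) {i + 1 + 1..i + 1 + k}" by auto
  ultimately show ?case by (simp del: trails.simps)
qed

lemma edge_walk_trail_backward:
  assumes "edge_walk X l x e" "k \<le> i" "i \<le> l"
  shows "e ` {i - k + 1..i} \<in> trails X k (x i)"
  using assms(2,3)
proof (induction k arbitrary: i)
  case 0
  then show ?case by simp
next
  case (Suc k)
  have "i \<in> {1..l}" using Suc.prems by auto
  then have e: "e i \<in> X" "x i \<in> e i" "x (i - 1) \<in> e i" "x (i - 1) \<noteq> x i"
    using assms(1) unfolding edge_walk_def by blast+
  have IH: "e ` {i - 1 - k + 1..i - 1} \<in> trails X k (x (i - 1))"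
    using Suc.IH[of "i - 1"] Suc.prems by simp
  have "e i \<notin> e ` {i - 1 - k + 1..i - 1}"
    using assms(1) Suc.prems unfolding edge_walk_def
    by (subst inj_on_image_mem_iff[where B = "{1..l}"]) auto
  then have "insert (e i) (e ` {i - 1 - k + 1..i - 1}) \<in> trails X (Suc k) (x i)"
    using e IH by (intro trails_SucI) auto
  moreover have "{i - Suc k + 1..i} = insert i {i - 1 - k + 1..i - 1}" using Suc.prems by auto
  ultimately show ?case by (simp del: trails.simps)
qed

text \<open>One trail runs backward from \<open>x (i - 1)\<close>, the other forward from
  \<open>x i\<close>. The witness stays within \<open>k\<close> edges of \<open>e i\<close>, so a
  segment around \<open>e i\<close> already exhibits it.\<close>

lemma edge_walk_bridge:
  assumes "edge_walk X l x e" "k < i" "i + k \<le> l"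
  shows "e ` {i - k..i + k} \<in> occurs (bridges X k (e i))"
proof -
  have i: "i \<in> {1..l}" using assms by auto
  then have e: "e i \<in> X" "x i \<in> e i" "x (i - 1) \<in> e i" "x (i - 1) \<noteq> x i" and inj: "inj_on e {1..l}"
    using assms(1) unfolding edge_walk_def by blast+
  have a: "e ` {i - k..i - 1} \<in> trails X k (x (i - 1))"
    using edge_walk_trail_backward[OF assms(1), of k "i - 1"] assms(2,3)
    by (simp add: Suc_diff_Suc)
  have b: "e ` {i + 1..i + k} \<in> trails X k (x i)"
    using edge_walk_trail_forward[OF assms(1,3)] .
  have "insert (e i) (e ` {i - k..i - 1} \<union> e ` {i + 1..i + k}) \<in> bridges X k (e i)"
  proof (rule bridgesI[OF e(3,2,4) a b])
    show "e ` {i - k..i - 1} \<inter> e ` {i + 1..i + k} = {}"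
      using assms by (subst inj_on_image_Int[OF inj, symmetric]) auto
    show "e i \<notin> e ` {i - k..i - 1}" "e i \<notin> e ` {i + 1..i + k}"
      using assms i by (subst inj_on_image_mem_iff[OF inj]; auto)+
  qed
  moreover have "insert (e i) (e ` {i - k..i - 1} \<union> e ` {i + 1..i + k}) \<subseteq> e ` {i - k..i + k}"
    by (auto intro!: imageI)
  ultimately show ?thesis unfolding occurs_def by blast
qed

text \<open>Consecutive segments of \<open>t\<close> edges form the packing: all edges of a segment
  except \<open>k\<close> at either end are bridges by means of the segment alone.\<close>

lemma edge_walk_packing:
  assumes "edge_walk X l x e" "e ` {1..l} \<subseteq> E" "finite X" "0 < t"
  shows "l div t \<le> packing_number
    {C \<in> Pow X. t - 2 * k \<le> card {e\<in>C. C \<in> occurs (bridges X k e)}} E"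
proof -
  define C where "C j = e ` {j * t + 1..j * t + t}" for j
  have inj: "inj_on e {1..l}" and X: "e ` {1..l} \<subseteq> X"
    using assms(1) unfolding edge_walk_def by auto
  have jt: "j * t + t \<le> l" if "j < l div t" for j
  proof -
    have "j * t + t = Suc j * t" by simp
    also have "\<dots> \<le> (l div t) * t" using that by (intro mult_right_mono) auto
    also have "\<dots> \<le> l" by simp
    finally show ?thesis .
  qed
  have dis: "C i \<inter> C j = {}" if "i < j" "j < l div t" for i j
  proof -
    have "i * t + t = Suc i * t" by simp
    also have "\<dots> \<le> j * t" using that by (intro mult_right_mono) auto
    finally have "{i * t + 1..i * t + t} \<inter> {j * t + 1..j * t + t} = {}" by auto
    moreover have "{i * t + 1..i * t + t} \<subseteq> {1..l}" "{j * t + 1..j * t + t} \<subseteq> {1..l}"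
      using jt[of i] jt[of j] that by auto
    ultimately show ?thesis
      unfolding C_def using inj_on_image_Int[OF inj] by (metis image_empty)
  qed
  then have dis': "C i \<inter> C j = {}" if "i \<noteq> j" "i < l div t" "j < l div t" for i j
    using that by (metis Int_commute linorder_neqE_nat)
  \<comment> \<open>Nonemptiness turns disjointness of the segments into injectivity of
    \<open>C\<close>.\<close>
  have ne: "C i \<noteq> {}" for i using assms(4) by (auto simp: C_def)
  have "inj_on C {..<l div t}"
    using dis' ne by (intro inj_onI) (metis Int_absorb lessThan_iff)
  then have "l div t = card (C ` {..<l div t})" by (simp add: card_image)
  also have "\<dots> \<le> packing_number
    {C \<in> Pow X. t - 2 * k \<le> card {e\<in>C. C \<in> occurs (bridges X k e)}} E"
  proof (rule packing_number_ge)
    show "C ` {..<l div t} \<subseteq> {C \<in> Pow X. t - 2 * k \<le> card {e\<in>C. C \<in> occurs (bridges X k e)}}"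
    proof (rule image_subsetI)
      fix j assume "j \<in> {..<l div t}"
      then have l: "j * t + t \<le> l" using jt by simp
      \<comment> \<open>Indices with \<open>k\<close> further edges of the segment on each side;
        empty for \<open>t \<le> 2 * k\<close>, in agreement with the truncated
        \<open>t - 2 * k\<close>.\<close>
      let ?I = "{j * t + k + 1..<j * t + t - k + 1}"
      have "e ` ?I \<subseteq> {e\<in>C j. C j \<in> occurs (bridges X k e)}"
      proof (rule image_subsetI)
        fix i assume i: "i \<in> ?I"
        then have "e ` {i - k..i + k} \<in> occurs (bridges X k (e i))"
          using l by (intro edge_walk_bridge[OF assms(1)]) auto
        moreover have "e ` {i - k..i + k} \<subseteq> C j"
          unfolding C_def using i by (intro image_mono) auto
        ultimately have "C j \<in> occurs (bridges X k (e i))" by (rule occurs_mono)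
        moreover have "e i \<in> C j" using i by (auto simp: C_def)
        ultimately show "e i \<in> {e\<in>C j. C j \<in> occurs (bridges X k e)}" by simp
      qed
      then have "card (e ` ?I) \<le> card {e\<in>C j. C j \<in> occurs (bridges X k e)}"
        by (intro card_mono) (auto simp: C_def)
      moreover have "inj_on e ?I" using l by (intro inj_on_subset[OF inj]) auto
      then have "card (e ` ?I) = t - 2 * k" by (simp add: card_image)
      moreover have "{j * t + 1..j * t + t} \<subseteq> {1..l}" using l by auto
      then have "C j \<subseteq> X" using X unfolding C_def by blast
      ultimately show "C j \<in> {C \<in> Pow X. t - 2 * k \<le> card {e\<in>C. C \<in> occurs (bridges X k e)}}"
        by simp
    qed
    show "disjoint (C ` {..<l div t})"
      unfolding disjoint_def using dis' by (metis image_iff lessThan_iff)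
    show "\<Union>(C ` {..<l div t}) \<subseteq> E"
    proof (rule UN_least)
      fix j assume "j \<in> {..<l div t}"
      then have "{j * t + 1..j * t + t} \<subseteq> {1..l}" using jt[of j] by auto
      then show "C j \<subseteq> E" using assms(2) unfolding C_def by blast
    qed
  qed (use assms in auto)
  finally show ?thesis .
qed

text \<open>The joints sit at the indices \<open>i * (r - 1) + 1\<close>. Distinct blocks of indices
  give distinct edges because \<open>v\<close> is injective.\<close>

lemma loose_path_edge_walk:
  assumes "loose_path r V E l v e" "2 \<le> r"
  shows "edge_walk {e. e \<subseteq> V \<and> card e = r} l (\<lambda>i. v (i * (r - 1) + 1)) e"
proof -
  define I where "I i = {(i - 1) * (r - 1) + 1..(i - 1) * (r - 1) + r}" for i
  have v: "v ` {1..l * (r - 1) + 1} \<subseteq> V" "inj_on v {1..l * (r - 1) + 1}"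
    and e: "\<And>i. i \<in> {1..l} \<Longrightarrow> e i = v ` I i"
    using assms(1) unfolding loose_path_def I_def by auto
  \<comment> \<open>The last index of a block is the first index of the next one.\<close>
  have last: "(i - 1) * (r - 1) + r = i * (r - 1) + 1" if "i \<in> {1..l}" for i
    using that assms(2) by (cases i; cases r) auto
  have I: "I i \<subseteq> {1..l * (r - 1) + 1}" if "i \<in> {1..l}" for i
  proof -
    have "i * (r - 1) \<le> l * (r - 1)" using that by (intro mult_right_mono) auto
    then show ?thesis unfolding I_def last[OF that] by auto
  qed
  have inj: "inj_on e {1..l}"
  proof (rule inj_onI)
    fix i j assume ij: "i \<in> {1..l}" "j \<in> {1..l}" "e i = e j"
    then have "I i = I j"
      using e I inj_on_image_eq_iff[OF v(2)] by metis
    then have "(i - 1) * (r - 1) = (j - 1) * (r - 1)"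
      using assms(2) by (simp add: I_def Icc_eq_Icc)
    then show "i = j" using assms(2) ij by auto
  qed
  show ?thesis unfolding edge_walk_def
  proof (intro conjI ballI inj CollectI)
    fix i assume i: "i \<in> {1..l}"
    show "e i \<subseteq> V" using e[OF i] I[OF i] v(1) by blast
    show "card (e i) = r"
      using e[OF i] inj_on_subset[OF v(2) I[OF i]] by (simp add: card_image I_def)
    have first: "(i - 1) * (r - 1) + 1 \<in> I i" and lst: "i * (r - 1) + 1 \<in> I i"
      using assms(2) last[OF i] by (auto simp: I_def)
    then show "v ((i - 1) * (r - 1) + 1) \<in> e i" "v (i * (r - 1) + 1) \<in> e i"
      using e[OF i] by blast+
    have "(i - 1) * (r - 1) + 1 \<noteq> i * (r - 1) + 1"
      using last[OF i] assms(2) by linarith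
    then show "v ((i - 1) * (r - 1) + 1) \<noteq> v (i * (r - 1) + 1)"
      using first lst I[OF i] inj_onD[OF v(2)] by blast
  qed
qed

section \<open>Longest loose paths and cycles\<close>

lemma loose_path_length_le:
  assumes "loose_path r V E l v e" "finite V"
  shows "l * (r - 1) + 1 \<le> card V"
  using card_inj_on_le[of v "{1..l * (r - 1) + 1}" V] assms unfolding loose_path_def by simp

lemma finite_loose_path_lengths:
  assumes "finite V" "2 \<le> r"
  shows "finite {l. \<exists>v e. loose_path r V E l v e}"
proof (rule finite_subset)
  show "{l. \<exists>v e. loose_path r V E l v e} \<subseteq> {..card V}"
  proof (rule subsetI)
    fix l assume "l \<in> {l. \<exists>v e. loose_path r V E l v e}"
    then obtain v e where "loose_path r V E l v e" by blast
    from loose_path_length_le[OF this assms(1)] have "l * (r - 1) \<le> card V" by simp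
    moreover have "l * 1 \<le> l * (r - 1)" using assms(2) by (intro mult_left_mono) auto
    ultimately show "l \<in> {..card V}" unfolding atMost_iff by linarith
  qed
qed simp

lemma longest_loose_path_cases:
  assumes "finite V" "2 \<le> r"
  obtains "longest_loose_path r V E = 0" |
    v e where "loose_path r V E (longest_loose_path r V E) v e"
proof -
  have "longest_loose_path r V E \<in> insert 0 {l. \<exists>v e. loose_path r V E l v e}"
    unfolding longest_loose_path_def
    using finite_loose_path_lengths[OF assms] by (intro Max_in) auto
  then show ?thesis using that by blast
qed

text \<open>Without its last edge a cycle involves only indices up to
  \<open>(l - 1) * (r - 1) + 1 \<le> l * (r - 1)\<close>, where \<open>v\<close> is injective; the
  repetition \<open>v (l * (r - 1) + 1) = v 1\<close> is avoided.\<close>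

lemma longest_loose_cycle_le:
  assumes "finite V" "3 \<le> r"
  shows "longest_loose_cycle r V E \<le> longest_loose_path r V E + 1"
proof -
  let ?C = "{l. \<exists>v e. loose_cycle r V E l v e}"
  have le: "l \<le> longest_loose_path r V E + 1" if "l \<in> ?C" for l
  proof -
    obtain v e where *: "loose_cycle r V E l v e" using \<open>l \<in> ?C\<close> by blast
    then have l: "1 \<le> l" by (simp add: loose_cycle_def)
    have "(l - 1) * (r - 1) + 1 \<le> l * (r - 1)"
      using l assms(2) by (cases l) auto
    then have "{1..(l - 1) * (r - 1) + 1} \<subseteq> {1..l * (r - 1)}" by auto
    moreover have "{1..l * (r - 1)} \<subseteq> {1..l * (r - 1) + 1}" by auto
    moreover have "{1..l - 1} \<subseteq> {1..l}" by auto
    ultimately have "loose_path r V E (l - 1) v e"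
      using * unfolding loose_path_def loose_cycle_def
      by (meson image_mono inj_on_subset order_trans subsetD)
    then have "l - 1 \<le> longest_loose_path r V E"
      unfolding longest_loose_path_def
      using finite_loose_path_lengths[of V r] assms by (intro Max_ge) auto
    then show ?thesis by simp
  qed
  then have "finite ?C"
    by (meson finite_nat_set_iff_bounded_le)
  then show ?thesis
    unfolding longest_loose_cycle_def using le by (subst Max_le_iff) auto
qed

text \<open>The additive \<open>t\<close> pays for the incomplete last segment.\<close>

lemma longest_loose_path_packing:
  assumes "finite V" "2 \<le> r" "0 < t"
  defines "X \<equiv> {e. e \<subseteq> V \<and> card e = r}"
  shows "longest_loose_path r V E \<le> t * packing_number
    {C \<in> Pow X. t - 2 * k \<le> card {e\<in>C. C \<in> occurs (bridges X k e)}} E + t"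
proof (cases rule: longest_loose_path_cases[OF assms(1,2), of E])
  case 1
  then show ?thesis by simp
next
  case (2 v e)
  let ?l = "longest_loose_path r V E"
  have "?l div t \<le> packing_number
    {C \<in> Pow X. t - 2 * k \<le> card {e\<in>C. C \<in> occurs (bridges X k e)}} E"
    unfolding X_def
  proof (rule edge_walk_packing[OF loose_path_edge_walk[OF 2 assms(2)]])
    show "e ` {1..?l} \<subseteq> E" using 2 unfolding loose_path_def by auto
  qed (use assms in auto)
  moreover have "?l \<le> t * (?l div t) + t"
    using assms(3) by (metis add_left_mono less_imp_le mod_less_divisor mult_div_mod_eq)
  ultimately show ?thesis
    by (meson add_le_mono1 mult_le_mono2 order_trans)
qed

section \<open>The longest loose path\<close>

lemma random_hypergraph_eq_random_subset:
  "random_hypergraph r n p = random_subset {e. e \<subseteq> {1..n} \<and> card e = r} p"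
  unfolding random_hypergraph_def random_subset_def ..

text \<open>Makes the claim trivial once the claimed coefficient of \<open>n\<close> is at least
  1.\<close>

lemma longest_loose_path_Suc_le:
  assumes "3 \<le> r" "1 \<le> n"
  shows "longest_loose_path r {1..n} E + 1 \<le> n"
proof (rule longest_loose_path_cases[of "{1..n}" r E])
  fix v e assume *: "loose_path r {1..n} E (longest_loose_path r {1..n} E) v e"
  let ?l = "longest_loose_path r {1..n} E"
  have "?l * (r - 1) + 1 \<le> n"
    using loose_path_length_le[OF *] by simp
  moreover have "?l * 1 \<le> ?l * (r - 1)" using assms by (intro mult_left_mono) auto
  ultimately show ?thesis by linarith
qed (use assms in auto)

text \<open>Here \<open>t\<close> stands for the extinction exponent at mean
  \<open>1 + x + x\<^sup>2\<close>. One factor \<open>1 + x\<close> comes from the expected number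
  of edges, the other from the segment ends.\<close>

lemma expansion_bound:
  fixes x t :: real
  assumes "0 < x" "x \<le> 1/4" "0 \<le> t" "t \<le> 2 * (x + x\<^sup>2) + 6 * (x + x\<^sup>2)\<^sup>2"
  shows "(1 + x)\<^sup>2 / 2 * t\<^sup>2 \<le> 2 * x\<^sup>2 + 80 * x ^ 3"
proof -
  have xx: "x\<^sup>2 \<le> x / 4" using assms by (simp add: power2_eq_square)
  have 1: "(1 + x)\<^sup>2 \<le> 1 + 9/4 * x" using xx by (simp add: power2_sum)
  have 2: "((1 + x)\<^sup>2)\<^sup>2 \<le> (1 + 9/4 * x)\<^sup>2" using 1 assms by (intro power_mono) auto
  also have "\<dots> \<le> 1 + 6 * x" using xx assms by (simp add: power2_sum power_mult_distrib power_divide)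
  finally have 3: "((1 + x)\<^sup>2)\<^sup>2 \<le> 1 + 6 * x" .
  have "(1 + 3 * x + 3 * x\<^sup>2)\<^sup>2 \<le> (1 + 15/4 * x)\<^sup>2" using xx assms by (intro power_mono) auto
  also have "\<dots> \<le> 1 + 12 * x" using xx assms(1) by (simp add: power2_sum power_mult_distrib power_divide)
  finally have 4: "(1 + 3 * x + 3 * x\<^sup>2)\<^sup>2 \<le> 1 + 12 * x" .
  have "t\<^sup>2 \<le> (2 * (x + x\<^sup>2) + 6 * (x + x\<^sup>2)\<^sup>2)\<^sup>2"
    using assms by (intro power_mono) auto
  \<comment> \<open>With \<open>y = x * (1 + x)\<close>, the bound
    \<open>2 * y + 6 * y\<^sup>2\<close> factors as
    \<open>2 * x * (1 + x) * (1 + 3 * x + 3 * x\<^sup>2)\<close>.\<close>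
  also have "\<dots> = 4 * x\<^sup>2 * ((1 + x)\<^sup>2 * (1 + 3 * x + 3 * x\<^sup>2)\<^sup>2)"
    by (simp add: algebra_simps power2_eq_square)
  finally have "(1 + x)\<^sup>2 / 2 * t\<^sup>2 \<le>
      (1 + x)\<^sup>2 / 2 * (4 * x\<^sup>2 * ((1 + x)\<^sup>2 * (1 + 3 * x + 3 * x\<^sup>2)\<^sup>2))"
    by (intro mult_left_mono) auto
  also have "\<dots> = 2 * x\<^sup>2 * (((1 + x)\<^sup>2)\<^sup>2 * (1 + 3 * x + 3 * x\<^sup>2)\<^sup>2)"
    by (simp add: power2_eq_square mult_ac)
  also have "\<dots> \<le> 2 * x\<^sup>2 * ((1 + 6 * x) * (1 + 12 * x))"
    using assms by (intro mult_left_mono mult_mono 3 4) auto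
  also have "(1 + 6 * x) * (1 + 12 * x) \<le> 1 + 40 * x"
  proof -
    have "(1 + 6 * x) * (1 + 12 * x) = 1 + 18 * x + 72 * x\<^sup>2"
      by (simp add: algebra_simps power2_eq_square)
    then show ?thesis using xx assms(1) by linarith
  qed
  then have "2 * x\<^sup>2 * ((1 + 6 * x) * (1 + 12 * x)) \<le> 2 * x\<^sup>2 * (1 + 40 * x)"
    by (intro mult_left_mono) auto
  also have "2 * x\<^sup>2 * (1 + 40 * x) = 2 * x\<^sup>2 + 80 * x ^ 3"
    by (simp add: algebra_simps power2_eq_square power3_eq_cube)
  finally show ?thesis .
qed

text \<open>The estimate for a single \<open>n\<close>. The condition on \<open>p\<close> lets the
  mean \<open>1 + (\<epsilon> + \<epsilon>\<^sup>2)\<close> absorb the correction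
  \<open>1 + 2 * p\<close>; the one on \<open>t\<close> limits the loss at segment ends to a factor
  \<open>1 + \<epsilon>\<close>; the one on \<open>n\<close> absorbs the incomplete segment and the
  \<open>+ 1\<close>.\<close>

lemma prob_longest_loose_path_large:
  fixes r n k t :: nat and \<epsilon> :: real
  defines "m \<equiv> real (r - 1)" and "N \<equiv> real ((n - 1) choose (r - 1))"
  defines "p \<equiv> (1 + \<epsilon>) / (m * N)"
  assumes "3 \<le> r" "1 \<le> n" "0 < \<epsilon>" "\<epsilon> \<le> 1/4" "0 < N" "2 * (1 + \<epsilon>) * p \<le> \<epsilon>\<^sup>2"
    and k: "extinction_exponent (1 + (\<epsilon> + \<epsilon>\<^sup>2)) k \<le> 2 * (\<epsilon> + \<epsilon>\<^sup>2) + 6 * (\<epsilon> + \<epsilon>\<^sup>2)\<^sup>2"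
    and t: "2 * Suc k < t" "real t \<le> (1 + \<epsilon>) * real (t - 2 * Suc k)"
    and n: "real (t + 1) \<le> \<epsilon> ^ 3 * real n"
  shows "measure_pmf.prob (random_hypergraph r n p)
      {E. (2 * \<epsilon>\<^sup>2 / m\<^sup>2 + 100 * \<epsilon> ^ 3) * real n < real (longest_loose_path r {1..n} E + 1)} \<le>
    (1 + \<epsilon>) / (m * real r) * (real t)\<^sup>2 / (\<epsilon> ^ 3)\<^sup>2 / real n"
proof -
  define X where "X = {e. e \<subseteq> {1..n} \<and> card e = r}"
  define \<T> where "\<T> = {C \<in> Pow X. t - 2 * Suc k \<le> card {e\<in>C. C \<in> occurs (bridges X (Suc k) e)}}"
  define s where "s = extinction_exponent (1 + (\<epsilon> + \<epsilon>\<^sup>2)) k"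
  define b where "b = real (r choose 2) * (p * (s / m)\<^sup>2)"
  \<comment> \<open>Chosen so that \<open>real t * a = \<epsilon> ^ 3 * real n\<close>: the
    deviation costs only a cubic term.\<close>
  define a where "a = \<epsilon> ^ 3 * real n / real t"
  define d where "d = real (t - 2 * Suc k)"
  have m: "2 \<le> m" using \<open>3 \<le> r\<close> by (simp add: m_def)
  have d: "0 < d" using t by (simp add: d_def)
  have p0: "0 < p" using m assms(6,8) by (simp add: p_def)
  have "1 * (2 * p) \<le> (1 + \<epsilon>) * (2 * p)"
    using p0 assms(6) by (intro mult_right_mono) auto
  also have "\<dots> \<le> \<epsilon>\<^sup>2" using assms(9) by (simp add: mult_ac)
  also have "\<dots> \<le> 1\<^sup>2" using assms(6,7) by (intro power_mono) auto
  finally have p1: "p \<le> 1/2" by simp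
  have s: "0 \<le> s" unfolding s_def using assms(6) by (intro extinction_exponent_nonneg) auto
  have fin: "finite X" unfolding X_def by simp
  \<comment> \<open>Double counting of incident pairs of a vertex and an edge; it yields the
    expected number of edges.\<close>
  have absorb: "r * (n choose r) = n * ((n - 1) choose (r - 1))"
    using binomial_absorption[of "r - 1" n] \<open>3 \<le> r\<close> by simp
  have card: "card X = n choose r" unfolding X_def by (simp add: n_subsets)
  have "real r * real (card X) = real n * N"
    using absorb unfolding card N_def by (metis of_nat_mult)
  then have cardp: "real (card X) * p = real n * (1 + \<epsilon>) / (m * real r)"
    using assms(4,8) m by (simp add: p_def field_simps)
  have choose: "2 * real (r choose 2) = real r * m"
    using binomial_absorption[of 1 r] unfolding m_def
    by (metis One_nat_def Suc_1 choose_one of_nat_mult of_nat_numeral)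
  have cardb: "real (card X) * b = real n * (1 + \<epsilon>) / 2 * (s / m)\<^sup>2"
  proof -
    have "real (card X) * b = (real (card X) * p) * (2 * real (r choose 2)) / 2 * (s / m)\<^sup>2"
      by (simp add: b_def)
    also have "\<dots> = real n * (1 + \<epsilon>) / 2 * (s / m)\<^sup>2"
      unfolding cardp choose using m assms(4) by simp
    finally show ?thesis .
  qed
  have q: "measure_pmf.prob (random_subset X p) (occurs (trails X (Suc k) u)) \<le> s / m"
    if "u \<in> {1..n}" for u
  proof -
    have "m * (N * p * (1 + 2 * p)) = (1 + \<epsilon>) * (1 + 2 * p)"
      using m assms(8) by (simp add: p_def)
    also have "\<dots> \<le> 1 + (\<epsilon> + \<epsilon>\<^sup>2)"
      using assms(9) by (simp add: algebra_simps)
    finally have "exp (- (s / m)) \<le> 1 - measure_pmf.prob (random_subset X p) (occurs (trails X (Suc k) u))"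
      unfolding s_def m_def N_def X_def using that p0 p1 \<open>3 \<le> r\<close>
      by (intro prob_not_trails_ge) auto
    then show ?thesis using exp_ge_add_one_self[of "- (s / m)"] by simp
  qed
  have bridge: "measure_pmf.prob (random_subset X p) (occurs (bridges X (Suc k) e)) \<le> b"
    if "e \<in> X" for e
    unfolding b_def X_def
  proof (rule prob_bridges_le)
    show "e \<in> {e. e \<subseteq> {1..n} \<and> card e = r}" using that by (simp add: X_def)
  qed (use q p0 p1 s m in \<open>auto simp: X_def\<close>)
  have main: "real (longest_loose_path r {1..n} E + 1) \<le> (2 * \<epsilon>\<^sup>2 / m\<^sup>2 + 100 * \<epsilon> ^ 3) * real n"
    if "real (packing_number \<T> E) < real (card X) * b / d + a" for E
  proof -
    have "longest_loose_path r {1..n} E \<le> t * packing_number \<T> E + t"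
      unfolding \<T>_def X_def using t(1) \<open>3 \<le> r\<close> by (intro longest_loose_path_packing) auto
    then have "real (longest_loose_path r {1..n} E + 1) \<le> real (t * packing_number \<T> E + t + 1)"
      unfolding of_nat_le_iff by simp
    also have "\<dots> = real t * real (packing_number \<T> E) + real (t + 1)" by simp
    also have "\<dots> \<le> real t * (real (card X) * b / d + a) + \<epsilon> ^ 3 * real n"
      using that by (intro add_mono mult_left_mono n) auto
    \<comment> \<open>One cubic term comes from the deviation \<open>a\<close>, the other from the
      incomplete segment.\<close>
    also have "\<dots> = real t / d * (real (card X) * b) + 2 * \<epsilon> ^ 3 * real n"
      using t(1) by (simp add: a_def algebra_simps)
    also have "\<dots> \<le> (1 + \<epsilon>) * (real (card X) * b) + 2 * \<epsilon> ^ 3 * real n"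
      using t(2) d p0 by (intro add_mono mult_right_mono) (use assms(6) in \<open>auto simp: d_def field_simps b_def\<close>)
    also have "\<dots> = (((1 + \<epsilon>)\<^sup>2 / 2 * s\<^sup>2) / m\<^sup>2 + 2 * \<epsilon> ^ 3) * real n"
      unfolding cardb by (simp add: power2_eq_square algebra_simps)
    also have "\<dots> \<le> ((2 * \<epsilon>\<^sup>2 + 80 * \<epsilon> ^ 3) / m\<^sup>2 + 2 * \<epsilon> ^ 3) * real n"
      using expansion_bound[OF assms(6,7) s k[folded s_def]] assms(6)
      by (intro mult_right_mono add_mono divide_right_mono) auto
    also have "\<dots> \<le> (2 * \<epsilon>\<^sup>2 / m\<^sup>2 + 100 * \<epsilon> ^ 3) * real n"
    proof (intro mult_right_mono)
      have "1\<^sup>2 \<le> m\<^sup>2" using m by (intro power_mono) auto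
      then have "80 * \<epsilon> ^ 3 / m\<^sup>2 \<le> 80 * \<epsilon> ^ 3 / 1"
        using assms(6) by (intro divide_left_mono) auto
      moreover have "0 \<le> \<epsilon> ^ 3" using assms(6) by simp
      ultimately show "(2 * \<epsilon>\<^sup>2 + 80 * \<epsilon> ^ 3) / m\<^sup>2 + 2 * \<epsilon> ^ 3 \<le> 2 * \<epsilon>\<^sup>2 / m\<^sup>2 + 100 * \<epsilon> ^ 3"
        unfolding add_divide_distrib by linarith
    qed simp
    finally show ?thesis .
  qed
  have "measure_pmf.prob (random_hypergraph r n p)
      {E. (2 * \<epsilon>\<^sup>2 / m\<^sup>2 + 100 * \<epsilon> ^ 3) * real n < real (longest_loose_path r {1..n} E + 1)} \<le>
    measure_pmf.prob (random_subset X p) {S. real (card X) * b / d + a \<le> real (packing_number \<T> S)}"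
    unfolding random_hypergraph_eq_random_subset X_def[symmetric]
    using main by (intro measure_pmf.finite_measure_mono) (auto simp flip: not_less)
  also have "\<dots> \<le> real (card X) * p / a\<^sup>2"
    unfolding d_def
  proof (rule prob_packing_number_large[OF fin])
    show "\<T> \<subseteq> Pow X" by (auto simp: \<T>_def)
    show "t - 2 * Suc k \<le> card {e\<in>C. C \<in> occurs (bridges X (Suc k) e)}" if "C \<in> \<T>" for C
      using that by (simp add: \<T>_def)
    show "0 < a" using assms(5,6) t(1) by (simp add: a_def)
  qed (use bridge p0 p1 t in auto)
  \<comment> \<open>Both \<open>a\<close> and the expected number of edges are linear in
    \<open>n\<close>, so the bound is of order 1/n.\<close>
  also have "\<dots> = (1 + \<epsilon>) / (m * real r) * (real t)\<^sup>2 / (\<epsilon> ^ 3)\<^sup>2 / real n"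
    unfolding cardp a_def using assms(5)
    by (simp add: power_divide power_mult_distrib power2_eq_square)
  finally show ?thesis .
qed

text \<open>Used to bound the edge probability by \<open>(1 + \<epsilon>) / (real n - 1)\<close>, so
  that it tends to 0.\<close>

lemma binomial_ge_linear:
  assumes "1 \<le> k" "k \<le> n"
  shows "real n \<le> real k * real (n choose k)"
proof -
  have "1 \<le> real n / real k" using assms by simp
  then have "(real n / real k) ^ 1 \<le> (real n / real k) ^ k"
    using assms(1) by (intro power_increasing) auto
  also have "\<dots> \<le> real (n choose k)"
    using binomial_ge_n_over_k_pow_k[OF assms(2), where 'a = real] by simp
  finally show ?thesis using assms by (simp add: field_simps)
qed

text \<open>Order of choices: \<open>k\<close> depends on \<open>\<epsilon>\<close>, then
  \<open>t\<close> on \<open>\<epsilon>\<close> and \<open>k\<close>, and finally \<open>n\<close>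
  is taken large.\<close>

lemma longest_loose_path_whp_small:
  fixes r :: nat and \<epsilon> :: real
  assumes "3 \<le> r" "0 < \<epsilon>" "\<epsilon> \<le> 1/4"
  shows "(\<lambda>n. measure_pmf.prob
        (random_hypergraph r n ((1 + \<epsilon>) / (real (r - 1) * real ((n - 1) choose (r - 1)))))
        {E. (2 * \<epsilon>\<^sup>2 / (real (r - 1))\<^sup>2 + 100 * \<epsilon> ^ 3) * real n <
            real (longest_loose_path r {1..n} E + 1)}) \<longlonglongrightarrow> 0"
proof -
  define p where "p n = (1 + \<epsilon>) / (real (r - 1) * real ((n - 1) choose (r - 1)))" for n
  have "\<epsilon>\<^sup>2 \<le> (1/4)\<^sup>2" using assms by (intro power_mono) auto
  then have \<delta>: "0 < \<epsilon> + \<epsilon>\<^sup>2" "\<epsilon> + \<epsilon>\<^sup>2 \<le> 1/2" using assms by (auto simp: add_pos_pos power2_eq_square)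
  then obtain k where k: "extinction_exponent (1 + (\<epsilon> + \<epsilon>\<^sup>2)) k \<le> 2 * (\<epsilon> + \<epsilon>\<^sup>2) + 6 * (\<epsilon> + \<epsilon>\<^sup>2)\<^sup>2"
    using extinction_exponent_eventually_small by blast
  \<comment> \<open>The ratio condition on \<open>t\<close> rearranges to \<open>real (2 * Suc k) *
    (1 + \<epsilon>) \<le> \<epsilon> * real t\<close>; the extra 1 secures the strict
    \<open>2 * Suc k < t\<close>.\<close>
  obtain t :: nat where t0: "real (2 * Suc k) * (1 + \<epsilon>) / \<epsilon> + 1 \<le> real t"
    using real_arch_simple by blast
  have "real (2 * Suc k) * (1 + \<epsilon>) / \<epsilon> = real (2 * Suc k) + real (2 * Suc k) / \<epsilon>"
    using assms by (simp add: field_simps)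
  moreover have "0 \<le> real (2 * Suc k) / \<epsilon>" using assms by simp
  ultimately have "real (2 * Suc k) < real t" using t0 by linarith
  then have t1: "2 * Suc k < t" unfolding of_nat_less_iff .
  have "real (2 * Suc k) * (1 + \<epsilon>) / \<epsilon> \<le> real t" using t0 by simp
  then have "real (2 * Suc k) * (1 + \<epsilon>) \<le> \<epsilon> * real t"
    using assms by (simp add: pos_divide_le_eq mult.commute)
  then have t2: "real t \<le> (1 + \<epsilon>) * real (t - 2 * Suc k)"
    using t1 by (simp add: of_nat_diff algebra_simps)
  have "eventually (\<lambda>n. 2 * (1 + \<epsilon>) * ((1 + \<epsilon>) / (real n - 1)) < \<epsilon>\<^sup>2) sequentially"
    using assms by real_asymp
  moreover have "eventually (\<lambda>n. real (t + 1) < \<epsilon> ^ 3 * real n) sequentially"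
    using assms by real_asymp
  moreover have "eventually (\<lambda>n. r < n) sequentially" by (rule eventually_gt_at_top)
  ultimately have upper: "eventually (\<lambda>n. measure_pmf.prob (random_hypergraph r n (p n))
        {E. (2 * \<epsilon>\<^sup>2 / (real (r - 1))\<^sup>2 + 100 * \<epsilon> ^ 3) * real n <
            real (longest_loose_path r {1..n} E + 1)} \<le>
        (1 + \<epsilon>) / (real (r - 1) * real r) * (real t)\<^sup>2 / (\<epsilon> ^ 3)\<^sup>2 / real n) sequentially"
  proof eventually_elim
    case (elim n)
    have "real (n - 1) \<le> real (r - 1) * real ((n - 1) choose (r - 1))"
      using elim assms by (intro binomial_ge_linear) auto
    then have "p n \<le> (1 + \<epsilon>) / (real n - 1)"
      using elim assms unfolding p_def by (intro divide_left_mono) (auto simp: of_nat_diff)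
    then have "2 * (1 + \<epsilon>) * p n \<le> 2 * (1 + \<epsilon>) * ((1 + \<epsilon>) / (real n - 1))"
      using assms by (intro mult_left_mono) auto
    then have "2 * (1 + \<epsilon>) * p n \<le> \<epsilon>\<^sup>2" using elim by linarith
    then show ?case
      unfolding p_def using elim assms k t1 t2
      by (intro prob_longest_loose_path_large[where k = k]) (auto simp: zero_less_binomial)
  qed
  have lim: "(\<lambda>n. (1 + \<epsilon>) / (real (r - 1) * real r) * (real t)\<^sup>2 / (\<epsilon> ^ 3)\<^sup>2 / real n) \<longlonglongrightarrow> 0"
    by (rule lim_const_over_n)
  show ?thesis
    by (rule tendsto_sandwich[OF _ upper[unfolded p_def] tendsto_const lim])
      (intro always_eventually allI measure_nonneg)
qed

theorem corollary1p8:
  fixes r :: nat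
  assumes "r \<ge> 3"
  shows "\<exists>(K::real) (g::real \<Rightarrow> real).
    (\<forall>\<epsilon>>0. \<bar>g \<epsilon>\<bar> \<le> K * \<epsilon> ^ 3) \<and>
    (\<forall>\<epsilon>>0.
      (\<lambda>n. measure_pmf.prob
             (random_hypergraph r n ((1 + \<epsilon>) / (real (r - 1) * real ((n - 1) choose (r - 1)))))
             {E. longest_loose_cycle r {1..n} E \<le> longest_loose_path r {1..n} E + 1 \<and>
                 real (longest_loose_path r {1..n} E + 1)
                   \<le> (2 * \<epsilon>\<^sup>2 / (real (r - 1))\<^sup>2 + g \<epsilon>) * real n})
        \<longlonglongrightarrow> 1)"
proof (intro exI conjI allI impI)
  \<comment> \<open>This instantiates the witnesses: \<open>K\<close> is 100 and \<open>g\<close> is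
    the cubic term itself.\<close>
  show "\<bar>(\<lambda>\<epsilon>. 100 * \<epsilon> ^ 3) \<epsilon>\<bar> \<le> 100 * \<epsilon> ^ 3" if "0 < \<epsilon>" for \<epsilon> :: real
    using that by simp
next
  fix \<epsilon> :: real assume \<epsilon>: "0 < \<epsilon>"
  let ?H = "\<lambda>n. random_hypergraph r n ((1 + \<epsilon>) / (real (r - 1) * real ((n - 1) choose (r - 1))))"
  let ?c = "2 * \<epsilon>\<^sup>2 / (real (r - 1))\<^sup>2 + 100 * \<epsilon> ^ 3"
  let ?B = "\<lambda>n. {E. ?c * real n < real (longest_loose_path r {1..n} E + 1)}"
  \<comment> \<open>The comparison of cycle and path holds for every \<open>E\<close>, so only the
    upper bound on paths can fail.\<close>
  have "{E. longest_loose_cycle r {1..n} E \<le> longest_loose_path r {1..n} E + 1 \<and>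
      real (longest_loose_path r {1..n} E + 1) \<le> ?c * real n} = UNIV - ?B n" for n
    using longest_loose_cycle_le[of "{1..n}" r] assms by (auto simp: not_less)
  then have eq: "measure_pmf.prob (?H n)
      {E. longest_loose_cycle r {1..n} E \<le> longest_loose_path r {1..n} E + 1 \<and>
        real (longest_loose_path r {1..n} E + 1) \<le> ?c * real n} =
      1 - measure_pmf.prob (?H n) (?B n)" for n
    using measure_pmf.prob_compl[of "?B n" "?H n"] by simp
  have "(\<lambda>n. measure_pmf.prob (?H n) (?B n)) \<longlonglongrightarrow> 0"
  proof (cases "\<epsilon> \<le> 1/4")
    case True
    then show ?thesis using longest_loose_path_whp_small assms \<epsilon> by blast
  next
    case False
    \<comment> \<open>Beyond 1/4 the cubic term alone is at least 100/64, hence the bound exceeds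
      \<open>n\<close>.\<close>
    then have "(1/4) ^ 3 \<le> \<epsilon> ^ 3" by (intro power_mono) auto
    moreover have "0 \<le> 2 * \<epsilon>\<^sup>2 / (real (r - 1))\<^sup>2" by simp
    moreover have "100 * (1/4 :: real) ^ 3 \<ge> 1" by (simp add: power3_eq_cube)
    ultimately have c: "1 \<le> ?c" by linarith
    have "eventually (\<lambda>n. measure_pmf.prob (?H n) (?B n) = 0) sequentially"
      using eventually_ge_at_top[of 1]
    proof eventually_elim
      case (elim n)
      have "real (longest_loose_path r {1..n} E + 1) \<le> ?c * real n" for E
      proof -
        have "real (longest_loose_path r {1..n} E + 1) \<le> 1 * real n"
          using longest_loose_path_Suc_le[OF assms elim, of E] by simp
        also have "\<dots> \<le> ?c * real n" using c by (intro mult_right_mono) auto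
        finally show ?thesis .
      qed
      then have "?B n = {}" by (auto simp: not_less)
      then show ?case by simp
    qed
    then show ?thesis by (rule tendsto_eventually)
  qed
  then have "(\<lambda>n. 1 - measure_pmf.prob (?H n) (?B n)) \<longlonglongrightarrow> 1 - 0"
    by (intro tendsto_diff tendsto_const)
  then show "(\<lambda>n. measure_pmf.prob (?H n)
      {E. longest_loose_cycle r {1..n} E \<le> longest_loose_path r {1..n} E + 1 \<and>
        real (longest_loose_path r {1..n} E + 1)
          \<le> (2 * \<epsilon>\<^sup>2 / (real (r - 1))\<^sup>2 + (\<lambda>\<epsilon>. 100 * \<epsilon> ^ 3) \<epsilon>) * real n}) \<longlonglongrightarrow> 1"
    unfolding eq by simp
qed

end
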